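(* Let $\tilde v,\tilde w$ be signed involutions of size $d$ with $\tilde v\in\overline{\mathfrak B_{\tilde w}}$ and $\operatorname{cd}_{\tilde v}=\operatorname{cd}_{\tilde w}-1$, forming a model rise of one of the six types listed below, with $\tilde\sigma=\tilde v\tilde w$ parametrized by signs $\alpha,\beta,\gamma\in\{\pm1\}$ as listed, and write $\tilde v(e_k)=\epsilon_ke_{v(k)}$. Then $o(\tilde v,\tilde w)=+1$, except that $o(\tilde v,\tilde w)=-1$ in exactly the following cases: - type $f\!f$ ($d=2$) with $(\epsilon_i,\alpha)=(+1,-1)$; - type $fe$ ($d=3$) with $(\epsilon_i,\beta)=(+1,-1)$; - type $ef$ ($d=3$) with $(\epsilon_j,\beta)=(-1,+1)$; - type $ee$ crossing ($d=4$) with $\alpha\beta=-1$ and $\gamma\epsilon_i=-1$; - type $ed$ ($d=4$) with $\beta=-1$. In particular, a non-crossing model $ee$-rise always has $o(\tilde v,\tilde w)=+1$.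
   Context: A signed involution of size $d$ is a signed permutation matrix $\tilde w$ with $\tilde w^2=1$; $w$ is the underlying permutation. $B^+$ is the group of real invertible upper triangular $d\times d$ matrices with positive diagonal. With $k$ determined by $\operatorname{Tr}\tilde w=d-2k$, let $G_k=\{g\in O(d):g^2=1,\operatorname{Tr}g=d-2k\}$ and $\mathfrak B_{\tilde w}=G_k\cap B^+\tilde wB^+$; these sets are the open cells of a CW structure on $G_k$, and $\operatorname{cd}_{\tilde w}=\dim\mathfrak B_{\tilde w}$ is the number of classes of inversions of $w$ ($i<j$, $w(i)>w(j)$) under $(i,j)\sim(w(j),w(i))$. Model rises (underlying permutations in cycle notation, the rise $(i,j)$ of $v$, and $\tilde\sigma=\tilde v\tilde w$): - $f\!f$: $d=2$, $v=\mathrm{id}$, $w=(12)$, $(i,j)=(1,2)$; $\tilde\sigma e_1=\alpha e_2$, $\tilde\sigma e_2=-\alpha e_1$. - $fe$: $d=3$, $v=(23)$, $w=(13)$, $(i,j)=(1,2)$; $\tilde\sigma e_1=\beta e_2$, $\tilde\sigma e_2=\alpha e_3$, $\tilde\sigma e_3=\alpha\beta e_1$. - $ef$: $d=3$, $v=(12)$, $w=(13)$, $(i,j)=(1,3)$; $\tilde\sigma e_1=\alpha e_3$, $\tilde\sigma e_3=\beta e_2$, $\tilde\sigma e_2=\alpha\beta e_1$. - $ee$ non-crossing: $d=4$, $v=(13)(24)$, $w=(14)(23)$, $(i,j)=(1,2)$; $\tilde\sigma e_1=\beta e_2$, $\tilde\sigma e_2=-\beta e_1$, $\tilde\sigma e_3=\alpha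 e_4$, $\tilde\sigma e_4=-\alpha e_3$. - $ee$ crossing: $d=4$, $v=(12)(34)$, $w=(14)$, $(i,j)=(1,3)$; $\tilde\sigma e_1=\gamma e_3$, $\tilde\sigma e_3=\alpha e_4$, $\tilde\sigma e_4=\beta e_2$, $\tilde\sigma e_2=-\alpha\beta\gamma e_1$. - $ed$: $d=4$, $v=(12)(34)$, $w=(13)(24)$, $(i,j)=(1,4)$; $\tilde\sigma e_1=\alpha e_4$, $\tilde\sigma e_4=-\alpha e_1$, $\tilde\sigma e_2=\beta e_3$, $\tilde\sigma e_3=-\beta e_2$. Definition of $o(\tilde v,\tilde w)$. For a signed involution $\tilde v$ the $(-1)$-eigenspace $E^-_{\tilde v}$ has as basis the nonzero vectors among $e_i-\tilde v(e_i)$ with $i\le v(i)$; ordering them by increasing $i$ gives the preferred orientation $\tilde v^+$ of $E^-_{\tilde v}$; the opposite one is $\tilde v^-$. Choose a continuous path $g:[0,1]\to G_k$ with $g(0)=\tilde w$, $g(1)=\tilde v$ and $g(t)\in\mathfrak B_{\tilde w}$ for $t<1$, and transport the orientation $\tilde w^+$ continuously along the $(-1)$-eigenspaces of $g(t)$ to an orientation of $E^-_{\tilde v}$ (the result does not depend on the path). Set $o(\tilde v,\tilde w)=+1$ if this is $\tilde v^+$ and $-1$ if it is $\tilde v^-$. *)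

theory Defs
  imports "Jordan_Normal_Form.Determinant" "HOL-Analysis.Analysis"
begin

no_notation vec_index (infixl "$" 100)
no_notation scalar_prod (infix "\<bullet>" 70)

type_synonym 'n rvec = "(real, 'n) Finite_Cartesian_Product.vec"
type_synonym 'n sqmat = "('n rvec, 'n) Finite_Cartesian_Product.vec"

text \<open>
  Matrices of size \<open>d = CARD('n)\<close> have their rows and columns indexed by an arbitrary finite linear
  order \<open>'n\<close>; \<open>ix k\<close> is its \<open>k\<close>-th smallest element, counting from 1.
\<close>

definition ix :: "nat \<Rightarrow> 'n::{finite,linorder}" where
  "ix k = sorted_list_of_set UNIV ! (k - 1)"

section \<open>Signed involutions and the cells\<close>

definition signed_perm_matrix :: "'n::{finite,linorder} sqmat \<Rightarrow> bool" where
  "signed_perm_matrix A \<longleftrightarrow>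
     (\<exists>p s. p permutes UNIV \<and> (\<forall>i. s i \<in> {1, -1}) \<and>
        (\<forall>i. A *v axis i 1 = s i *\<^sub>R axis (p i) 1))"

definition signed_involution :: "'n::{finite,linorder} sqmat \<Rightarrow> bool" where
  "signed_involution A \<longleftrightarrow> signed_perm_matrix A \<and> A ** A = mat 1"

text \<open>For a signed permutation matrix, \<open>A e\<^sub>i = entry_sign A i e\<^bsub>under_perm A i\<^esub>\<close>.\<close>

definition under_perm :: "'n::{finite,linorder} sqmat \<Rightarrow> 'n \<Rightarrow> 'n" where
  "under_perm A i = (THE j. A $ j $ i \<noteq> 0)"

definition entry_sign :: "'n::{finite,linorder} sqmat \<Rightarrow> 'n \<Rightarrow> real" where
  "entry_sign A i = A $ under_perm A i $ i"

definition Bplus :: "('n::{finite,linorder} sqmat) set" where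
  "Bplus = {b. invertible b \<and> (\<forall>i j. j < i \<longrightarrow> b $ i $ j = 0) \<and> (\<forall>i. b $ i $ i > 0)}"

definition Gk :: "nat \<Rightarrow> ('n::{finite,linorder} sqmat) set" where
  "Gk k = {g. orthogonal_matrix g \<and> g ** g = mat 1 \<and> trace g = real CARD('n) - 2 * real k}"

definition neg_index :: "'n::{finite,linorder} sqmat \<Rightarrow> nat" where
  "neg_index w = (THE k. trace w = real CARD('n) - 2 * real k)"

definition cell :: "'n::{finite,linorder} sqmat \<Rightarrow> ('n sqmat) set" where
  "cell w = Gk (neg_index w) \<inter> {b ** w ** b' | b b'. b \<in> Bplus \<and> b' \<in> Bplus}"

definition inversions :: "('n::{finite,linorder} \<Rightarrow> 'n) \<Rightarrow> ('n \<times> 'n) set" where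
  "inversions p = {(i, j). i < j \<and> p i > p j}"

definition inversion_rel :: "('n::{finite,linorder} \<Rightarrow> 'n) \<Rightarrow> (('n \<times> 'n) \<times> ('n \<times> 'n)) set" where
  "inversion_rel p = {((i, j), (k, l)). (i, j) \<in> inversions p \<and> (k, l) \<in> inversions p \<and>
     ((k, l) = (i, j) \<or> (k, l) = (p j, p i))}"

text \<open>
  The dimension of \<open>cell w\<close>, given by its combinatorial formula: the number of classes of inversions
  of the underlying permutation under \<open>(i, j) \<sim> (w j, w i)\<close>.
\<close>

definition cell_dim :: "'n::{finite,linorder} sqmat \<Rightarrow> nat" where
  "cell_dim w = card (inversions (under_perm w) // inversion_rel (under_perm w))"

section \<open>Orientations of subspaces and their transport\<close>

definition ordered_basis :: "'a::euclidean_space set \<Rightarrow> 'a list \<Rightarrow> bool" where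
  "ordered_basis V bs \<longleftrightarrow> distinct bs \<and> independent (set bs) \<and> span (set bs) = V"

definition same_orientation :: "'a::euclidean_space list \<Rightarrow> 'a list \<Rightarrow> bool" where
  "same_orientation bs cs \<longleftrightarrow> length cs = length bs \<and>
     (\<exists>M. (\<forall>j < length bs. cs ! j = (\<Sum>i < length bs. M (i, j) *\<^sub>R bs ! i)) \<and>
        Determinant.det (Matrix.mat (length bs) (length bs) M) > 0)"

text \<open>An orientation of \<open>V\<close> is a class of ordered bases of \<open>V\<close>.\<close>

definition orientation_of :: "'a::euclidean_space set \<Rightarrow> 'a list \<Rightarrow> 'a list set" where
  "orientation_of V bs = {cs. ordered_basis V cs \<and> same_orientation bs cs}"

definition is_orientation :: "'a::euclidean_space set \<Rightarrow> 'a list set \<Rightarrow> bool" where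
  "is_orientation V X \<longleftrightarrow> (\<exists>bs. ordered_basis V bs \<and> X = orientation_of V bs)"

definition opposite_orientation :: "'a::euclidean_space set \<Rightarrow> 'a list set \<Rightarrow> 'a list set" where
  "opposite_orientation V X = {cs. ordered_basis V cs \<and> cs \<notin> X}"

definition neg_eigenspace :: "'n::{finite,linorder} sqmat \<Rightarrow> 'n rvec set" where
  "neg_eigenspace g = {x. g *v x = - x}"

definition preferred_basis :: "'n::{finite,linorder} sqmat \<Rightarrow> 'n rvec list" where
  "preferred_basis v =
     filter (\<lambda>x. x \<noteq> 0)
       (map (\<lambda>i. axis i 1 - v *v axis i 1)
          (filter (\<lambda>i. i \<le> under_perm v i) (sorted_list_of_set UNIV)))"

definition pos_orientation :: "'n::{finite,linorder} sqmat \<Rightarrow> 'n rvec list set" where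
  "pos_orientation v = orientation_of (neg_eigenspace v) (preferred_basis v)"

definition neg_orientation :: "'n::{finite,linorder} sqmat \<Rightarrow> 'n rvec list set" where
  "neg_orientation v = opposite_orientation (neg_eigenspace v) (pos_orientation v)"

definition cell_path :: "'n::{finite,linorder} sqmat \<Rightarrow> 'n sqmat \<Rightarrow> (real \<Rightarrow> 'n sqmat) \<Rightarrow> bool"
  where
  "cell_path v w g \<longleftrightarrow> path g \<and> path_image g \<subseteq> Gk (neg_index w) \<and>
     pathstart g = w \<and> pathfinish g = v \<and> (\<forall>t\<in>{0..<1}. g t \<in> cell w)"

text \<open>
  \<open>X\<close> is a continuous choice of orientations \<open>X t\<close> of the \<open>(-1)\<close>-eigenspaces of \<open>g t\<close>: near every
  parameter it is represented by a continuous moving frame.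
\<close>

definition continuous_orientation ::
    "(real \<Rightarrow> 'n::{finite,linorder} sqmat) \<Rightarrow> (real \<Rightarrow> 'n rvec list set) \<Rightarrow> bool" where
  "continuous_orientation g X \<longleftrightarrow>
     (\<forall>t\<in>{0..1}. is_orientation (neg_eigenspace (g t)) (X t)) \<and>
     (\<forall>t\<in>{0..1}. \<exists>U b. open U \<and> t \<in> U \<and>
        (\<forall>s \<in> U \<inter> {0..1}. b s \<in> X s) \<and>
        (\<forall>i < length (b t). continuous_on (U \<inter> {0..1}) (\<lambda>s. b s ! i)))"

definition orient_sign :: "'n::{finite,linorder} sqmat \<Rightarrow> 'n sqmat \<Rightarrow> int" where
  "orient_sign v w = (THE s. \<exists>g X. cell_path v w g \<and> continuous_orientation g X \<and>
     X 0 = pos_orientation w \<and>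
     (s = 1 \<and> X 1 = pos_orientation v \<or> s = -1 \<and> X 1 = neg_orientation v))"

section \<open>Model rises\<close>

datatype rise_type = FF | FE | EF | EE_noncrossing | EE_crossing | ED

text \<open>
  \<open>model_rise T v w i j \<alpha> \<beta> \<gamma>\<close>: the pair \<open>v\<close>, \<open>w\<close> is a model rise of type \<open>T\<close> at the rise \<open>(i, j)\<close> of
  \<open>v\<close>. Signs that do not occur in the parametrization of a type are left unconstrained.
\<close>

definition model_rise :: "rise_type \<Rightarrow> 'n::{finite,linorder} sqmat \<Rightarrow> 'n sqmat \<Rightarrow>
    'n \<Rightarrow> 'n \<Rightarrow> real \<Rightarrow> real \<Rightarrow> real \<Rightarrow> bool" where
  "model_rise T v w i j \<alpha> \<beta> \<gamma> \<longleftrightarrow>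
    (let e = (\<lambda>k. axis (ix k) 1 :: 'n rvec);
         \<sigma> = (\<lambda>k. (v ** w) *v e k);
         cyc = (\<lambda>a b. Transposition.transpose (ix a) (ix b) :: 'n \<Rightarrow> 'n)
     in case T of
       FF \<Rightarrow> CARD('n) = 2 \<and> under_perm v = id \<and> under_perm w = cyc 1 2 \<and>
         (i, j) = (ix 1, ix 2) \<and>
         \<sigma> 1 = \<alpha> *\<^sub>R e 2 \<and> \<sigma> 2 = - \<alpha> *\<^sub>R e 1
     | FE \<Rightarrow> CARD('n) = 3 \<and> under_perm v = cyc 2 3 \<and> under_perm w = cyc 1 3 \<and>
         (i, j) = (ix 1, ix 2) \<and>
         \<sigma> 1 = \<beta> *\<^sub>R e 2 \<and> \<sigma> 2 = \<alpha> *\<^sub>R e 3 \<and> \<sigma> 3 = (\<alpha> * \<beta>) *\<^sub>R e 1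
     | EF \<Rightarrow> CARD('n) = 3 \<and> under_perm v = cyc 1 2 \<and> under_perm w = cyc 1 3 \<and>
         (i, j) = (ix 1, ix 3) \<and>
         \<sigma> 1 = \<alpha> *\<^sub>R e 3 \<and> \<sigma> 3 = \<beta> *\<^sub>R e 2 \<and> \<sigma> 2 = (\<alpha> * \<beta>) *\<^sub>R e 1
     | EE_noncrossing \<Rightarrow> CARD('n) = 4 \<and>
         under_perm v = cyc 1 3 \<circ> cyc 2 4 \<and> under_perm w = cyc 1 4 \<circ> cyc 2 3 \<and>
         (i, j) = (ix 1, ix 2) \<and>
         \<sigma> 1 = \<beta> *\<^sub>R e 2 \<and> \<sigma> 2 = - \<beta> *\<^sub>R e 1 \<and> \<sigma> 3 = \<alpha> *\<^sub>R e 4 \<and> \<sigma> 4 = - \<alpha> *\<^sub>R e 3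
     | EE_crossing \<Rightarrow> CARD('n) = 4 \<and>
         under_perm v = cyc 1 2 \<circ> cyc 3 4 \<and> under_perm w = cyc 1 4 \<and>
         (i, j) = (ix 1, ix 3) \<and>
         \<sigma> 1 = \<gamma> *\<^sub>R e 3 \<and> \<sigma> 3 = \<alpha> *\<^sub>R e 4 \<and> \<sigma> 4 = \<beta> *\<^sub>R e 2 \<and>
         \<sigma> 2 = - (\<alpha> * \<beta> * \<gamma>) *\<^sub>R e 1
     | ED \<Rightarrow> CARD('n) = 4 \<and>
         under_perm v = cyc 1 2 \<circ> cyc 3 4 \<and> under_perm w = cyc 1 3 \<circ> cyc 2 4 \<and>
         (i, j) = (ix 1, ix 4) \<and>
         \<sigma> 1 = \<alpha> *\<^sub>R e 4 \<and> \<sigma> 4 = - \<alpha> *\<^sub>R e 1 \<and> \<sigma> 2 = \<beta> *\<^sub>R e 3 \<and> \<sigma> 3 = - \<beta> *\<^sub>R e 2)"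

end

theory Submission
  imports Defs
begin

text \<open>\<open>orient_sign\<close> is a definite description, so it needs one path with a
  continuous orientation and agreement of all such choices. The determinant settles agreement for
  every path at once, without any topology of the cell; for existence, the orthogonal projections of
  \<open>xs\<close> to the (-1)-eigenspaces form a continuous frame. The obstacle is that one
  \<open>xs\<close> must serve both the whole cell and \<open>v\<close>. Leading coordinates offer
  two index sets: w(m) < m or w(m) > m, each joined by the m with w e_m = - e_m; both have k
  elements. In types ff, fe, ef and crossing ee exactly one of them is transversal to the eigenspace
  of \<open>v\<close>, and the signs decide which. Where the set with w(m) > m serves, the result is
  +1; exceptions in these types arise only from the other set. In type ed neither serves, and a
  mixed pair is used. If \<sigma>^2 = -1 (types ff, non-crossing ee, ed), \<open>v\<close> and
  \<open>w\<close> anticommute, so t v + sqrt(1 - t^2) w is an involution. Types fe and ef rotate a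
  coordinate plane; crossing ee needs a less obvious curve.\<close>

text \<open>
  Choose signed coordinate vectors \<open>xs\<close> such that neither \<open>E\<^sup>-\<^sub>v\<close> nor any \<open>E\<^sup>-\<^sub>h\<close> with \<open>h\<close> in the cell of
  \<open>w\<close> contains a nonzero vector orthogonal to all of \<open>xs\<close>. Then the determinant of the inner products
  of a moving frame with \<open>xs\<close> cannot change sign along a path in the cell that ends at \<open>v\<close>, so
  \<open>o(v, w)\<close> is read off from the preferred bases of \<open>w\<close> and \<open>v\<close>. That such coordinates exist follows
  from \<open>h = b w b'\<close>: the topmost nonzero coordinate \<open>m\<close> of a \<open>(-1)\<close>-eigenvector of \<open>h\<close> satisfies
  \<open>w(m) < m\<close> or \<open>w e\<^sub>m = - e\<^sub>m\<close>, and dually for the lowest one. A path is given by an explicit symmetric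
  \<open>g(t)\<close> with \<open>g(t) b(t) = b(t) w\<close> for some upper triangular \<open>b(t)\<close> with positive diagonal.
\<close>

section \<open>Determinants with respect to a reference frame\<close>

definition frame_det :: "'a::euclidean_space list \<Rightarrow> 'a list \<Rightarrow> real" where
  "frame_det xs bs =
     Determinant.det (Matrix.mat (length xs) (length xs) (\<lambda>(i, j). xs ! i \<bullet> bs ! j))"

definition transversal :: "'a::euclidean_space set \<Rightarrow> 'a list \<Rightarrow> bool" where
  "transversal V xs \<longleftrightarrow> (\<forall>y\<in>V. (\<forall>x\<in>set xs. x \<bullet> y = 0) \<longrightarrow> y = 0)"

text \<open>A kernel vector of the matrix of inner products is a coefficient vector \<open>c\<close>
  whose combination of \<open>bs\<close> is orthogonal to every reference vector. Both independence
  and transversality arguments go through this form.\<close>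

lemma frame_det_eq_0_iff:
  "frame_det xs bs = 0 \<longleftrightarrow>
     (\<exists>c. (\<exists>j<length xs. c j \<noteq> 0) \<and>
        (\<forall>i<length xs. xs ! i \<bullet> (\<Sum>j<length xs. c j *\<^sub>R bs ! j) = 0))"
proof -
  define n where "n = length xs"
  define A where "A = Matrix.mat n n (\<lambda>(i, j). xs ! i \<bullet> bs ! j)"
  have A: "A \<in> carrier_mat n n"
    by (simp add: A_def)
  have entry: "Matrix.vec_index (A *\<^sub>v Matrix.vec n c) i = xs ! i \<bullet> (\<Sum>j<n. c j *\<^sub>R bs ! j)"
    if "i < n" for c i
    using that
    by (simp add: A_def scalar_prod_def inner_sum_right lessThan_atLeast0 mult.commute)
  have "frame_det xs bs = 0 \<longleftrightarrow> (\<exists>x. x \<in> carrier_vec n \<and> x \<noteq> 0\<^sub>v n \<and> A *\<^sub>v x = 0\<^sub>v n)"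
    using det_0_iff_vec_prod_zero_field[OF A] by (simp add: frame_det_def A_def n_def)
  also have "\<dots> \<longleftrightarrow> (\<exists>c. Matrix.vec n c \<noteq> 0\<^sub>v n \<and> A *\<^sub>v Matrix.vec n c = 0\<^sub>v n)"
  proof
    assume "\<exists>x. x \<in> carrier_vec n \<and> x \<noteq> 0\<^sub>v n \<and> A *\<^sub>v x = 0\<^sub>v n"
    then obtain x where x: "x \<in> carrier_vec n" "x \<noteq> 0\<^sub>v n" "A *\<^sub>v x = 0\<^sub>v n" by blast
    have "x = Matrix.vec n (Matrix.vec_index x)"
      using x(1) by (intro eq_vecI) auto
    with x(2,3) show "\<exists>c. Matrix.vec n c \<noteq> 0\<^sub>v n \<and> A *\<^sub>v Matrix.vec n c = 0\<^sub>v n"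
      by metis
  next
    assume "\<exists>c. Matrix.vec n c \<noteq> 0\<^sub>v n \<and> A *\<^sub>v Matrix.vec n c = 0\<^sub>v n"
    then show "\<exists>x. x \<in> carrier_vec n \<and> x \<noteq> 0\<^sub>v n \<and> A *\<^sub>v x = 0\<^sub>v n"
      using vec_carrier by blast
  qed
  also have "\<dots> \<longleftrightarrow> (\<exists>c. (\<exists>j<n. c j \<noteq> 0) \<and> (\<forall>i<n. xs ! i \<bullet> (\<Sum>j<n. c j *\<^sub>R bs ! j) = 0))"
  proof -
    have "Matrix.vec n c \<noteq> 0\<^sub>v n \<longleftrightarrow> (\<exists>j<n. c j \<noteq> 0)" for c :: "nat \<Rightarrow> real"
      by (auto simp: vec_eq_iff Matrix.vec_eq_iff)
    moreover have "A *\<^sub>v Matrix.vec n c = 0\<^sub>v n \<longleftrightarrow>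
        (\<forall>i<n. xs ! i \<bullet> (\<Sum>j<n. c j *\<^sub>R bs ! j) = 0)" for c
    proof -
      have "A *\<^sub>v Matrix.vec n c = 0\<^sub>v n \<longleftrightarrow>
          (\<forall>i<n. Matrix.vec_index (A *\<^sub>v Matrix.vec n c) i = 0)"
        using A by (auto simp: Matrix.vec_eq_iff simp del: index_mult_mat_vec)
      then show ?thesis using entry by simp
    qed
    ultimately show ?thesis by simp
  qed
  finally show ?thesis by (simp add: n_def)
qed

lemma frame_det_change_of_basis:
  assumes "length bs = length xs"
    and "\<And>j. j < length xs \<Longrightarrow> cs ! j = (\<Sum>i<length xs. M (i, j) *\<^sub>R bs ! i)"
  shows "frame_det xs cs =
    frame_det xs bs * Determinant.det (Matrix.mat (length xs) (length xs) M)"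
proof -
  let ?n = "length xs"
  have "Matrix.mat ?n ?n (\<lambda>(i, j). xs ! i \<bullet> cs ! j) =
      Matrix.mat ?n ?n (\<lambda>(i, j). xs ! i \<bullet> bs ! j) * Matrix.mat ?n ?n M"
    by (rule eq_matI)
       (auto simp: assms scalar_prod_def inner_sum_right lessThan_atLeast0 mult.commute)
  then show ?thesis
    by (simp add: frame_det_def det_mult[of _ ?n])
qed

lemma ordered_basis_length:
  assumes "ordered_basis V bs"
  shows "length bs = dim V"
  using assms by (metis distinct_card dim_span_eq_card_independent ordered_basis_def)

lemma sum_list_nth_eq_sum_set:
  fixes bs :: "'a::real_vector list"
  assumes "distinct bs"
  shows "(\<Sum>j<length bs. f (bs ! j)) = (\<Sum>b\<in>set bs. f b)"
  using sum.reindex_bij_betw[OF bij_betw_nth[OF assms refl refl]] by (simp add: lessThan_atLeast0)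

lemma ordered_basis_combination:
  assumes "ordered_basis V bs" "y \<in> V"
  obtains c where "y = (\<Sum>j<length bs. c j *\<^sub>R bs ! j)"
proof -
  have "y \<in> span (set bs)" using assms by (simp add: ordered_basis_def)
  then obtain u where "y = (\<Sum>b\<in>set bs. u b *\<^sub>R b)"
    by (auto simp: span_finite)
  then have "y = (\<Sum>j<length bs. u (bs ! j) *\<^sub>R bs ! j)"
    using assms sum_list_nth_eq_sum_set[of bs "\<lambda>b. u b *\<^sub>R b"] by (simp add: ordered_basis_def)
  then show thesis by (rule that)
qed

lemma ordered_basis_combination_eq_0:
  assumes "ordered_basis V bs" "(\<Sum>j<length bs. c j *\<^sub>R bs ! j) = 0" "j < length bs"
  shows "c j = 0"
proof -
  have d: "distinct bs" and i: "independent (set bs)"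
    using assms(1) by (auto simp: ordered_basis_def)
  \<comment> \<open>Distinctness makes the position of a basis vector unique, so coefficients
    indexed by position become coefficients indexed by vector.\<close>
  define u where "u b = c (THE j. j < length bs \<and> bs ! j = b)" for b
  have u: "u (bs ! j) = c j" if "j < length bs" for j
    unfolding u_def using that d
    by (intro arg_cong[where f = c] the_equality) (auto simp: nth_eq_iff_index_eq)
  have "(\<Sum>b\<in>set bs. u b *\<^sub>R b) = (\<Sum>j<length bs. u (bs ! j) *\<^sub>R bs ! j)"
    using sum_list_nth_eq_sum_set[OF d, of "\<lambda>b. u b *\<^sub>R b"] by simp
  also have "\<dots> = 0"
    using assms(2) u by simp
  finally have "\<forall>b\<in>set bs. u b = 0"
    using i independent_explicit_finite_subsets[of "set bs"] by blast
  then show ?thesis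
    using u[OF assms(3)] assms(3) by force
qed

lemma ordered_basis_frame_det_ne_0:
  assumes "subspace V" "transversal V xs" "ordered_basis V bs" "length bs = length xs"
  shows "frame_det xs bs \<noteq> 0"
proof
  assume "frame_det xs bs = 0"
  then obtain c j where c: "j < length xs" "c j \<noteq> 0"
      "\<forall>i<length xs. xs ! i \<bullet> (\<Sum>j<length xs. c j *\<^sub>R bs ! j) = 0"
    unfolding frame_det_eq_0_iff by blast
  let ?y = "\<Sum>j<length xs. c j *\<^sub>R bs ! j"
  have "set bs \<subseteq> V"
    using assms(3) by (auto simp: ordered_basis_def intro: span_base)
  then have "?y \<in> V"
    using assms(4) by (intro subspace_sum[OF assms(1)] subspace_scale[OF assms(1)]) auto
  moreover have "\<forall>x\<in>set xs. x \<bullet> ?y = 0"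
    using c(3) by (auto simp: in_set_conv_nth)
  ultimately have "?y = 0"
    using assms(2) by (auto simp: transversal_def)
  then show False
    using ordered_basis_combination_eq_0[OF assms(3)] c(1,2) assms(4) by metis
qed

text \<open>A nonzero determinant excludes every nontrivial relation among \<open>bs\<close>, and
  independent vectors in \<open>V\<close> that are as many as its dimension span it.\<close>

lemma ordered_basis_if_frame_det_ne_0:
  assumes "subspace V" "set bs \<subseteq> V" "length bs = length xs" "dim V = length xs"
    and "frame_det xs bs \<noteq> 0"
  shows "ordered_basis V bs"
proof -
  have no: "j < length xs \<Longrightarrow> c j = 0"
    if "(\<Sum>j<length xs. c j *\<^sub>R bs ! j) = 0" for c j
    using assms(5) that unfolding frame_det_eq_0_iff by auto
  have d: "distinct bs"
    unfolding distinct_conv_nth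
  proof (intro allI impI notI)
    fix i j assume ij: "i < length bs" "j < length bs" "i \<noteq> j" "bs ! i = bs ! j"
    \<comment> \<open>A repeated entry would be the relation
      \<open>bs ! i - bs ! j = 0\<close>.\<close>
    let ?c = "\<lambda>k. (if k = i then 1 else 0) - (if k = j then 1 else 0 :: real)"
    have "(\<Sum>k<length xs. ?c k *\<^sub>R bs ! k) = 0"
      using ij assms(3) by (simp add: scaleR_left_diff_distrib sum_subtractf if_distrib[of "\<lambda>r. r *\<^sub>R _"]
          cong: if_cong)
    from no[OF this, of i] ij assms(3) show False by simp
  qed
  have i: "independent (set bs)"
    unfolding independent_explicit_finite_subsets
  proof (intro allI impI ballI)
    fix A u a assume A: "A \<subseteq> set bs" "finite A" "(\<Sum>v\<in>A. u v *\<^sub>R v) = 0" "a \<in> A"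
    define u' where "u' v = (if v \<in> A then u v else 0)" for v
    have "(\<Sum>v\<in>A. u v *\<^sub>R v) = (\<Sum>v\<in>set bs. u' v *\<^sub>R v)"
      using A(1) by (intro sum.mono_neutral_cong_left) (auto simp: u'_def)
    also have "\<dots> = (\<Sum>j<length xs. u' (bs ! j) *\<^sub>R bs ! j)"
      using sum_list_nth_eq_sum_set[OF d, of "\<lambda>b. u' b *\<^sub>R b"] assms(3) by simp
    finally have "(\<Sum>j<length xs. u' (bs ! j) *\<^sub>R bs ! j) = 0"
      using A(3) by simp
    from no[OF this] have "u' a = 0"
      using A(1,4) assms(3) by (auto simp: in_set_conv_nth subset_eq)
    then show "u a = 0" using A(4) by (simp add: u'_def)
  qed
  have "span (set bs) = V"
    using card_ge_dim_independent[OF assms(2) i] assms(1,2,3,4) d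
    by (metis antisym distinct_card order_refl span_minimal)
  then show ?thesis using d i by (simp add: ordered_basis_def)
qed

text \<open>With \<open>M\<close> the transition matrix, the product equals the square of
  \<open>frame_det xs bs\<close> times det \<open>M\<close>, and transversality makes that square
  positive.\<close>

lemma same_orientation_iff_frame_det:
  assumes "subspace V" "transversal V xs" "ordered_basis V bs" "ordered_basis V cs"
    and "dim V = length xs"
  shows "same_orientation bs cs \<longleftrightarrow> frame_det xs bs * frame_det xs cs > 0"
proof -
  let ?n = "length xs"
  have len: "length bs = ?n" "length cs = ?n"
    using assms(3-5) by (simp_all add: ordered_basis_length)
  have nz: "frame_det xs bs \<noteq> 0"
    using ordered_basis_frame_det_ne_0 assms len by blast
  have pos: "frame_det xs bs * frame_det xs cs > 0 \<longleftrightarrow>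
      Determinant.det (Matrix.mat ?n ?n M) > 0"
    if "\<And>j. j < ?n \<Longrightarrow> cs ! j = (\<Sum>i<?n. M (i, j) *\<^sub>R bs ! i)" for M
    using frame_det_change_of_basis[OF len(1) that] nz
    by (auto simp: zero_less_mult_iff mult_less_0_iff)
  have "\<exists>c. b = (\<Sum>i<?n. c i *\<^sub>R bs ! i)" if "b \<in> V" for b
    using ordered_basis_combination[OF assms(3) that] len by metis
  then obtain C where C: "\<And>b. b \<in> V \<Longrightarrow> b = (\<Sum>i<?n. C b i *\<^sub>R bs ! i)"
    by metis
  have "cs ! j \<in> V" if "j < ?n" for j
    using that assms(4) len(2) by (auto simp: ordered_basis_def intro: span_base)
  then have "cs ! j = (\<Sum>i<?n. (\<lambda>(i, j). C (cs ! j) i) (i, j) *\<^sub>R bs ! i)" if "j < ?n" for j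
    using C that by simp
  then have ex: "\<exists>M. \<forall>j<?n. cs ! j = (\<Sum>i<?n. M (i, j) *\<^sub>R bs ! i)" by blast
  show ?thesis
    unfolding same_orientation_def len using ex pos by metis
qed

lemma orientation_of_eq_frame_det:
  assumes "subspace V" "transversal V xs" "ordered_basis V bs" "dim V = length xs"
  shows "orientation_of V bs = {cs. ordered_basis V cs \<and> frame_det xs bs * frame_det xs cs > 0}"
  using same_orientation_iff_frame_det assms by (auto simp: orientation_of_def)

section \<open>Transport of orientations\<close>

lemma subspace_neg_eigenspace: "subspace (neg_eigenspace g)"
  by (auto simp: subspace_def neg_eigenspace_def matrix_vector_right_distrib
      matrix_vector_mult_scaleR)

text \<open>For \<open>g\<close> in \<open>Gk k\<close> this is the orthogonal projection (1 - g)/2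
  onto the (-1)-eigenspace; it depends continuously on \<open>g\<close>.\<close>

definition neg_projection :: "'n::{finite,linorder} sqmat \<Rightarrow> 'n rvec \<Rightarrow> 'n rvec" where
  "neg_projection g x = (1/2) *\<^sub>R (x - g *v x)"

lemma Gk_symmetric:
  assumes "g \<in> Gk k"
  shows "Finite_Cartesian_Product.transpose g = g"
proof -
  have "Finite_Cartesian_Product.transpose g ** g = mat 1" "g ** g = mat 1"
    using assms by (auto simp: Gk_def orthogonal_matrix)
  then show ?thesis
    by (metis matrix_mul_assoc matrix_mul_lid matrix_mul_rid)
qed

lemma Gk_inner:
  assumes "g \<in> Gk k"
  shows "(g *v x) \<bullet> y = x \<bullet> (g *v y)"
  using Gk_symmetric[OF assms] by (metis dot_lmul_matrix vector_transpose_matrix)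

lemma neg_projection_in:
  assumes "g \<in> Gk k"
  shows "neg_projection g x \<in> neg_eigenspace g"
proof -
  have "g *v (g *v x) = x"
    using assms by (simp add: Gk_def matrix_vector_mul_assoc)
  then show ?thesis
    by (simp add: neg_projection_def neg_eigenspace_def matrix_vector_mult_scaleR
        matrix_vector_mult_diff_distrib flip: scaleR_minus_right)
qed

lemma inner_neg_projection:
  assumes "g \<in> Gk k" "y \<in> neg_eigenspace g"
  shows "neg_projection g x \<bullet> y = x \<bullet> y"
  using assms by (simp add: neg_projection_def neg_eigenspace_def inner_diff_left Gk_inner[OF assms(1)])

text \<open>The trace of an orthogonal projection is the dimension of its image, and (1 - g)/2 has
  trace k.\<close>

lemma dim_neg_eigenspace:
  fixes g :: "'n::{finite,linorder} sqmat"
  assumes "g \<in> Gk k"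
  shows "dim (neg_eigenspace g) = k"
proof -
  let ?V = "neg_eigenspace g"
  obtain B where B: "B \<subseteq> ?V" "pairwise orthogonal B" "\<And>x. x \<in> B \<Longrightarrow> norm x = 1"
      "independent B" "card B = dim ?V" "span B = ?V"
    using orthonormal_basis_subspace[OF subspace_neg_eigenspace] by metis
  have fin: "finite B"
    using B(4) by (rule independent_imp_finite)
  \<comment> \<open>Orthonormal expansion of the projection; it turns the trace below into the sum
    of the squared norms of \<open>B\<close>.\<close>
  have expand: "neg_projection g x = (\<Sum>b\<in>B. (x \<bullet> b) *\<^sub>R b)" for x
  proof -
    let ?y = "neg_projection g x"
    obtain u where u: "?y = (\<Sum>b\<in>B. u b *\<^sub>R b)"
      using neg_projection_in[OF assms, of x] B(6) by (auto simp: span_finite[OF fin])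
    have "u b = x \<bullet> b" if "b \<in> B" for b
    proof -
      have "x \<bullet> b = ?y \<bullet> b"
        using inner_neg_projection[OF assms] B(1) that by (simp add: subset_eq)
      also have "\<dots> = (\<Sum>c\<in>B. u c * (c \<bullet> b))"
        by (simp add: u inner_sum_left)
      also have "\<dots> = (\<Sum>c\<in>B. if c = b then u b else 0)"
      proof (rule sum.cong)
        fix c assume "c \<in> B"
        then show "u c * (c \<bullet> b) = (if c = b then u b else 0)"
          using B(2,3) that by (auto simp: pairwise_def orthogonal_def norm_eq_1)
      qed simp
      finally show ?thesis using fin that by simp
    qed
    then show ?thesis using u by simp
  qed
  have "real CARD('n) - trace g = 2 * (\<Sum>i\<in>UNIV. neg_projection g (axis i 1) $ i)"
    by (simp add: trace_def neg_projection_def matrix_vector_mult_basis column_def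
        sum_subtractf flip: sum_divide_distrib)
  also have "\<dots> = 2 * (\<Sum>i\<in>UNIV. \<Sum>b\<in>B. b $ i * b $ i)"
    by (simp add: expand inner_axis' )
  also have "\<dots> = 2 * (\<Sum>b\<in>B. b \<bullet> b)"
    by (subst sum.swap) (simp add: inner_vec_def)
  also have "\<dots> = 2 * real (card B)"
    using B(3) by (simp add: norm_eq_1)
  finally show ?thesis
    using assms B(5) by (simp add: Gk_def)
qed

lemma preferred_basis_subset:
  assumes "v ** v = mat 1"
  shows "set (preferred_basis v) \<subseteq> neg_eigenspace v"
  using assms
  by (auto simp: preferred_basis_def neg_eigenspace_def matrix_vector_mult_diff_distrib
      matrix_vector_mul_assoc)

lemma continuous_on_frame_det:
  assumes "\<And>i. i < length xs \<Longrightarrow> continuous_on S (\<lambda>s. b s ! i)"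
  shows "continuous_on S (\<lambda>s. frame_det xs (b s))"
proof -
  have "continuous_on S (\<lambda>s. \<Sum>p\<in>{p. p permutes {0..<length xs}}.
      signof p * (\<Prod>i=0..<length xs. xs ! i \<bullet> b s ! p i))"
    by (intro continuous_intros assms) (auto dest: permutes_in_image)
  moreover have "frame_det xs (b s) = (\<Sum>p\<in>{p. p permutes {0..<length xs}}.
      signof p * (\<Prod>i=0..<length xs. xs ! i \<bullet> b s ! p i))" for s
    unfolding frame_det_def
    by (subst det_def'[of _ "length xs"]) (auto intro!: sum.cong prod.cong dest: permutes_in_image)
  ultimately show ?thesis by simp
qed

lemma is_orientation_frame_det:
  assumes "subspace V" "transversal V xs" "dim V = length xs" "is_orientation V X"
  shows "X \<noteq> {}" and "b \<in> X \<Longrightarrow> ordered_basis V b \<and> frame_det xs b \<noteq> 0"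
    and "\<lbrakk>b \<in> X; c \<in> X\<rbrakk> \<Longrightarrow> frame_det xs b * frame_det xs c > 0"
proof -
  obtain a where a: "ordered_basis V a" "X = orientation_of V a"
    using assms(4) by (auto simp: is_orientation_def)
  have X: "X = {c. ordered_basis V c \<and> frame_det xs a * frame_det xs c > 0}"
    using orientation_of_eq_frame_det[OF assms(1,2) a(1) assms(3)] a(2) by simp
  have "frame_det xs a \<noteq> 0"
    using ordered_basis_frame_det_ne_0[OF assms(1,2) a(1)] ordered_basis_length[OF a(1)] assms(3)
    by simp
  then show "X \<noteq> {}" "b \<in> X \<Longrightarrow> ordered_basis V b \<and> frame_det xs b \<noteq> 0"
      "\<lbrakk>b \<in> X; c \<in> X\<rbrakk> \<Longrightarrow> frame_det xs b * frame_det xs c > 0"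
    using a(1) by (auto simp: X zero_less_mult_iff)
qed

text \<open>Over a path whose \<open>(-1)\<close>-eigenspaces all project isomorphically to the span of \<open>xs\<close>, the sign
  of \<open>frame_det xs\<close> distinguishes the two orientations, so it cannot jump.\<close>

lemma continuous_orientation_frame_det:
  assumes X: "continuous_orientation g X"
    and g: "\<And>t. t \<in> {0..1} \<Longrightarrow> g t \<in> Gk (length xs)"
      "\<And>t. t \<in> {0..1} \<Longrightarrow> transversal (neg_eigenspace (g t)) xs"
    and b: "b \<in> X 0" and c: "c \<in> X 1"
  shows "frame_det xs b * frame_det xs c > 0"
proof -
  have or: "is_orientation (neg_eigenspace (g t)) (X t)" if "t \<in> {0..1}" for t
    using X that by (simp add: continuous_orientation_def)
  note fd = is_orientation_frame_det[OF subspace_neg_eigenspace g(2) dim_neg_eigenspace[OF g(1)] or]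
  \<comment> \<open>Quantifying over all frames in \<open>X s\<close> and \<open>X t\<close> makes
    \<open>R\<close> independent of the local frames. It is an equivalence relation with relatively
    open classes, so connectedness of the interval relates 0 to 1.\<close>
  define R where "R s t \<longleftrightarrow> s \<in> {0..1} \<and> t \<in> {0..1} \<and>
    (\<forall>b\<in>X s. \<forall>c\<in>X t. frame_det xs b * frame_det xs c > 0)" for s t
  have "R 0 1"
  proof (rule connected_equivalence_relation[of "{0..1}" 0 1 R])
    fix s t u :: real
    assume a: "R s t" "R t u"
    then obtain b where b: "b \<in> X t" using fd(1)[of t] by (auto simp: R_def)
    have "frame_det xs a' * frame_det xs c > 0" if "a' \<in> X s" "c \<in> X u" for a' c
    proof -
      have "frame_det xs a' * frame_det xs b > 0" "frame_det xs b * frame_det xs c > 0"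
        using a b that by (auto simp: R_def)
      then show ?thesis by (auto simp: zero_less_mult_iff)
    qed
    then show "R s u" using a by (simp add: R_def)
  next
    show "R t s" if "R s t" for s t
    proof -
      have "frame_det xs c * frame_det xs b > 0" if "c \<in> X t" "b \<in> X s" for b c
        using \<open>R s t\<close> that by (subst mult.commute) (auto simp: R_def)
      then show ?thesis using that by (simp add: R_def)
    qed
  next
    fix t :: real assume t: "t \<in> {0..1}"
    then obtain U b where U: "open U" "t \<in> U" "\<And>s. s \<in> U \<inter> {0..1} \<Longrightarrow> b s \<in> X s"
        "\<And>i. i < length (b t) \<Longrightarrow> continuous_on (U \<inter> {0..1}) (\<lambda>s. b s ! i)"
      using X unfolding continuous_orientation_def by meson
    let ?S = "U \<inter> {0..1}"
    have bt: "b t \<in> X t" using U(2,3) t by blast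
    have "length (b t) = length xs"
      using fd(2)[OF t t t bt] by (metis ordered_basis_length dim_neg_eigenspace[OF g(1)[OF t]])
    then have "continuous_on ?S (\<lambda>s. frame_det xs (b t) * frame_det xs (b s))"
      using U(4) by (intro continuous_intros continuous_on_frame_det) simp
    then have "openin (top_of_set ?S)
        (?S \<inter> (\<lambda>s. frame_det xs (b t) * frame_det xs (b s)) -` {0<..})"
      by (rule continuous_openin_preimage_gen) simp
    moreover have "openin (top_of_set {0..1}) ?S"
      using openin_open_Int[OF U(1), of "{0..1}"] by (simp add: Int_commute)
    ultimately have "openin (top_of_set {0..1})
        (?S \<inter> (\<lambda>s. frame_det xs (b t) * frame_det xs (b s)) -` {0<..})" (is "openin _ ?T")
      by (rule openin_trans)
    moreover have "t \<in> ?T"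
      using U(2) t fd(3)[OF t t t bt bt] by simp
    moreover have "R t s" if "s \<in> ?T" for s
    proof -
      have s: "s \<in> {0..1}" "b s \<in> X s" "frame_det xs (b t) * frame_det xs (b s) > 0"
        using that U(3) by auto
      have "frame_det xs c * frame_det xs d > 0" if "c \<in> X t" "d \<in> X s" for c d
        using fd(3)[OF t t t bt that(1)] fd(3)[OF s(1,1,1,2) that(2)] s(3)
        by (auto simp: zero_less_mult_iff)
      then show ?thesis using t s(1) by (simp add: R_def)
    qed
    ultimately show "\<exists>T. openin (top_of_set {0..1}) T \<and> t \<in> T \<and> (\<forall>x\<in>T. R t x)" by blast
  qed simp_all
  then show ?thesis using b c unfolding R_def by blast
qed

section \<open>Existence of a continuous orientation by orthogonal projection\<close>

lemma ordered_basis_exists: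
  fixes V :: "'a::euclidean_space set"
  assumes "subspace V"
  obtains bs where "ordered_basis V bs"
proof -
  obtain B where B: "B \<subseteq> V" "independent B" "V \<subseteq> span B"
    using basis_exists[of V] by metis
  obtain bs where "set bs = B" "distinct bs"
    using finite_distinct_list[OF independent_imp_finite[OF B(2)]] by blast
  moreover have "span B = V"
    using B span_minimal[OF B(1) assms] by blast
  ultimately show thesis
    using B(2) that[of bs] by (simp add: ordered_basis_def)
qed

text \<open>If some combination of the projections is orthogonal to \<open>xs\<close>,
  transversality makes it zero; then the same combination of \<open>xs\<close> is orthogonal to the
  eigenspace, which contradicts the nonvanishing determinant of \<open>xs\<close> against a
  basis.\<close>

lemma ordered_basis_neg_projection:
  assumes g: "g \<in> Gk (length xs)" and tr: "transversal (neg_eigenspace g) xs"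
  shows "ordered_basis (neg_eigenspace g) (map (neg_projection g) xs)"
proof (rule ordered_basis_if_frame_det_ne_0[OF subspace_neg_eigenspace, of _ _ xs])
  let ?V = "neg_eigenspace g" and ?bs = "map (neg_projection g) xs" and ?n = "length xs"
  show "set ?bs \<subseteq> ?V" "length ?bs = ?n" "dim ?V = ?n"
    using neg_projection_in[OF g] dim_neg_eigenspace[OF g] by auto
  show "frame_det xs ?bs \<noteq> 0"
  proof
    assume "frame_det xs ?bs = 0"
    then obtain c j where c: "j < ?n" "c j \<noteq> 0"
        "\<forall>i<?n. xs ! i \<bullet> (\<Sum>j<?n. c j *\<^sub>R ?bs ! j) = 0"
      unfolding frame_det_eq_0_iff by blast
    let ?y = "\<Sum>j<?n. c j *\<^sub>R ?bs ! j" and ?x = "\<Sum>j<?n. c j *\<^sub>R xs ! j"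
    have "?y \<in> ?V"
      using neg_projection_in[OF g]
      by (intro subspace_sum[OF subspace_neg_eigenspace] subspace_scale[OF subspace_neg_eigenspace])
        auto
    moreover have "\<forall>x\<in>set xs. x \<bullet> ?y = 0"
      using c(3) by (auto simp: in_set_conv_nth)
    ultimately have y: "?y = 0"
      using tr by (auto simp: transversal_def)
    have orth: "?x \<bullet> z = 0" if "z \<in> ?V" for z
    proof -
      have "?x \<bullet> z = ?y \<bullet> z"
        by (auto simp: inner_sum_left inner_neg_projection[OF g that] intro!: sum.cong)
      then show ?thesis unfolding y by simp
    qed
    obtain bs where bs: "ordered_basis ?V bs"
      using ordered_basis_exists[OF subspace_neg_eigenspace] .
    have len: "length bs = ?n"
      using bs dim_neg_eigenspace[OF g] ordered_basis_length by metis
    have "frame_det bs xs = 0"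
      unfolding frame_det_eq_0_iff len
    proof (intro exI[of _ c] conjI allI impI)
      show "\<exists>j<?n. c j \<noteq> 0" using c(1,2) by blast
      fix i assume "i < ?n"
      then have "bs ! i \<in> ?V"
        using bs len span_base[of "bs ! i" "set bs"] by (simp add: ordered_basis_def)
      then show "bs ! i \<bullet> ?x = 0"
        using orth by (simp add: inner_commute)
    qed
    \<comment> \<open>Exchanging the two families transposes the matrix, so transversality by
      \<open>xs\<close> also forbids a combination of \<open>xs\<close> orthogonal to
      \<open>bs\<close>.\<close>
    moreover have "frame_det bs xs = frame_det xs bs"
    proof -
      have "Matrix.mat ?n ?n (\<lambda>(i, j). bs ! i \<bullet> xs ! j) =
          Matrix.transpose_mat (Matrix.mat ?n ?n (\<lambda>(i, j). xs ! i \<bullet> bs ! j))"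
        by (rule eq_matI) (auto simp: inner_commute)
      then show ?thesis
        by (simp add: frame_det_def len Determinant.det_transpose[of _ ?n])
    qed
    ultimately show False
      using ordered_basis_frame_det_ne_0[OF subspace_neg_eigenspace tr bs len] by simp
  qed
qed

lemma continuous_orientation_neg_projection:
  assumes "path g"
    and g: "\<And>t. t \<in> {0..1} \<Longrightarrow> g t \<in> Gk (length xs)"
      "\<And>t. t \<in> {0..1} \<Longrightarrow> transversal (neg_eigenspace (g t)) xs"
  shows "continuous_orientation g
    (\<lambda>t. orientation_of (neg_eigenspace (g t)) (map (neg_projection (g t)) xs))"
  unfolding continuous_orientation_def
proof (intro conjI ballI)
  fix t :: real assume t: "t \<in> {0..1}"
  show "is_orientation (neg_eigenspace (g t))
      (orientation_of (neg_eigenspace (g t)) (map (neg_projection (g t)) xs))"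
    using ordered_basis_neg_projection[OF g(1)[OF t] g(2)[OF t]] by (auto simp: is_orientation_def)
  have "continuous_on {0..1} (\<lambda>s. neg_projection (g s) x)" for x
    unfolding neg_projection_def matrix_vector_mult_def
    using assms(1) unfolding path_def
    by (intro continuous_intros continuous_on_component) auto
  moreover have "map (neg_projection (g s)) xs
      \<in> orientation_of (neg_eigenspace (g s)) (map (neg_projection (g s)) xs)" if "s \<in> {0..1}" for s
  proof -
    note ob = ordered_basis_neg_projection[OF g(1)[OF that] g(2)[OF that]]
    then show ?thesis
      using ordered_basis_frame_det_ne_0[OF subspace_neg_eigenspace g(2)[OF that] ob]
      by (simp add: orientation_of_eq_frame_det[OF subspace_neg_eigenspace g(2)[OF that] ob
            dim_neg_eigenspace[OF g(1)[OF that]]] zero_less_mult_iff linorder_neq_iff disj_commute)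
  \<comment> \<open>The projected frame is continuous along the whole path, so the local frame
    required by the definition can be taken with \<open>U = UNIV\<close>.\<close>
  qed
  ultimately show "\<exists>U b. open U \<and> t \<in> U \<and> (\<forall>s\<in>U \<inter> {0..1}. b s
          \<in> orientation_of (neg_eigenspace (g s)) (map (neg_projection (g s)) xs)) \<and>
        (\<forall>i<length (b t). continuous_on (U \<inter> {0..1}) (\<lambda>s. b s ! i))"
    by (intro exI[of _ UNIV] exI[of _ "\<lambda>s. map (neg_projection (g s)) xs"]) simp
qed

text \<open>As \<open>xs\<close> is normalised to be positive on the preferred basis of
  \<open>w\<close>, positivity is transported to the other end, where the preferred basis of
  \<open>v\<close> is compared with it.\<close>

lemma orient_sign_eq_frame_det:
  assumes path: "cell_path v w g" and k: "neg_index w = length xs"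
    and tr: "\<And>h. h \<in> insert v (cell w) \<Longrightarrow> transversal (neg_eigenspace h) xs"
    and w: "length (preferred_basis w) = length xs" "frame_det xs (preferred_basis w) > 0"
      "frame_det xs (map (neg_projection w) xs) > 0"
    and v: "length (preferred_basis v) = length xs" "frame_det xs (preferred_basis v) \<noteq> 0"
  shows "orient_sign v w = (if frame_det xs (preferred_basis v) > 0 then 1 else -1)"
proof -
  let ?D = "frame_det xs"
  have *: "g t \<in> Gk (length xs) \<and> transversal (neg_eigenspace (g t)) xs"
    if "cell_path v w g" "t \<in> {0..1}" for g t
  proof (cases "t = 1")
    case True
    then have "g t = v" using that by (simp add: cell_path_def pathfinish_def)
    then show ?thesis using that tr k by (auto simp: cell_path_def path_image_def)
  next
    case False
    then have "g t \<in> cell w" using that by (simp add: cell_path_def)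
    then show ?thesis using tr k by (auto simp: cell_def)
  qed
  have ends: "g 0 = w" "g 1 = v" if "cell_path v w g" for g
    using that by (auto simp: cell_path_def pathstart_def pathfinish_def)
  have wG: "w \<in> Gk (length xs)" and wT: "transversal (neg_eigenspace w) xs"
    using *[OF path, of 0] ends[OF path] by auto
  have vG: "v \<in> Gk (length xs)" and vT: "transversal (neg_eigenspace v) xs"
    using *[OF path, of 1] ends[OF path] by auto
  have obw: "ordered_basis (neg_eigenspace w) (preferred_basis w)"
    using wG w by (intro ordered_basis_if_frame_det_ne_0[of _ _ xs] subspace_neg_eigenspace
        preferred_basis_subset dim_neg_eigenspace) (auto simp: Gk_def)
  have obv: "ordered_basis (neg_eigenspace v) (preferred_basis v)"
    using vG v by (intro ordered_basis_if_frame_det_ne_0[of _ _ xs] subspace_neg_eigenspace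
        preferred_basis_subset dim_neg_eigenspace) (auto simp: Gk_def)
  have posw: "pos_orientation w =
      {c. ordered_basis (neg_eigenspace w) c \<and> ?D (preferred_basis w) * ?D c > 0}"
    unfolding pos_orientation_def using wG
    by (intro orientation_of_eq_frame_det subspace_neg_eigenspace wT obw dim_neg_eigenspace)
  have posv: "pos_orientation v =
      {c. ordered_basis (neg_eigenspace v) c \<and> ?D (preferred_basis v) * ?D c > 0}"
    unfolding pos_orientation_def using vG
    by (intro orientation_of_eq_frame_det subspace_neg_eigenspace vT obv dim_neg_eigenspace)
  have nz: "?D c \<noteq> 0" if "ordered_basis (neg_eigenspace v) c" for c
    using that ordered_basis_length[OF that] dim_neg_eigenspace[OF vG]
    by (intro ordered_basis_frame_det_ne_0[OF subspace_neg_eigenspace vT]) auto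
  have negv: "neg_orientation v =
      {c. ordered_basis (neg_eigenspace v) c \<and> ?D (preferred_basis v) * ?D c < 0}"
    unfolding neg_orientation_def opposite_orientation_def posv
    using nz v(2) by (auto simp: not_less order.order_iff_strict zero_less_mult_iff mult_less_0_iff)
  \<comment> \<open>Uniqueness half of the definite description: path and orientation are arbitrary
    here.\<close>
  have sign: "(X 1 = pos_orientation v \<longrightarrow> ?D (preferred_basis v) > 0) \<and>
      (X 1 = neg_orientation v \<longrightarrow> ?D (preferred_basis v) < 0)"
    if "cell_path v w g" "continuous_orientation g X" "X 0 = pos_orientation w" for g X
  proof -
    have "preferred_basis w \<in> X 0"
      using that(3) posw obw w(2) by simp
    then have pos: "?D c > 0" if "c \<in> X 1" for c
      using continuous_orientation_frame_det[OF \<open>continuous_orientation g X\<close>, of xs "preferred_basis w" c]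
        *[OF \<open>cell_path v w g\<close>] that w(2) by (auto simp: zero_less_mult_iff)
    have "is_orientation (neg_eigenspace v) (X 1)"
      using that(2) ends[OF that(1)] by (auto simp: continuous_orientation_def)
    then obtain c where c: "c \<in> X 1"
      using is_orientation_frame_det(1)[OF subspace_neg_eigenspace vT dim_neg_eigenspace[OF vG]]
      by blast
    then show ?thesis
      using pos[OF c] posv negv by (auto simp: zero_less_mult_iff mult_less_0_iff)
  qed
  \<comment> \<open>Existence half: the orientation by projected frames over the given path starts
    at the preferred one, since the projections of \<open>xs\<close> also have positive determinant
    at \<open>w\<close>.\<close>
  define X where
    "X t = orientation_of (neg_eigenspace (g t)) (map (neg_projection (g t)) xs)" for t
  have X: "continuous_orientation g X"
    unfolding X_def using *[OF path] path
    by (intro continuous_orientation_neg_projection) (auto simp: cell_path_def)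
  have X0: "X 0 = pos_orientation w"
  proof -
    have "X 0 = {c. ordered_basis (neg_eigenspace w) c \<and>
        ?D (map (neg_projection w) xs) * ?D c > 0}"
      unfolding X_def ends[OF path] using wG
      by (intro orientation_of_eq_frame_det subspace_neg_eigenspace wT dim_neg_eigenspace
          ordered_basis_neg_projection)
    then show ?thesis
      using posw w(2,3) by (auto simp: zero_less_mult_iff)
  qed
  have X1: "X 1 = {c. ordered_basis (neg_eigenspace v) c \<and>
      ?D (map (neg_projection v) xs) * ?D c > 0}"
    unfolding X_def ends[OF path] using vG
    by (intro orientation_of_eq_frame_det subspace_neg_eigenspace vT dim_neg_eigenspace
        ordered_basis_neg_projection)
  have "?D (map (neg_projection v) xs) \<noteq> 0"
    using nz ordered_basis_neg_projection[OF vG vT] by blast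
  then have X1': "X 1 = pos_orientation v \<or> X 1 = neg_orientation v"
    using v(2) unfolding X1 posv negv 
    by (cases "?D (map (neg_projection v) xs) > 0"; cases "?D (preferred_basis v) > 0")
       (auto simp: zero_less_mult_iff mult_less_0_iff)
  show ?thesis
    unfolding orient_sign_def
  proof (rule the_equality)
    show "\<exists>g X. cell_path v w g \<and> continuous_orientation g X \<and> X 0 = pos_orientation w \<and>
        ((if ?D (preferred_basis v) > 0 then 1 else -1::int) = 1 \<and> X 1 = pos_orientation v \<or>
         (if ?D (preferred_basis v) > 0 then 1 else -1::int) = -1 \<and> X 1 = neg_orientation v)"
      using path X X0 X1' sign[OF path X X0] by (intro exI[of _ g] exI[of _ X]) auto
  next
    fix s :: int
    assume "\<exists>g X. cell_path v w g \<and> continuous_orientation g X \<and> X 0 = pos_orientation w \<and>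
        (s = 1 \<and> X 1 = pos_orientation v \<or> s = -1 \<and> X 1 = neg_orientation v)"
    then obtain g X where gX: "cell_path v w g" "continuous_orientation g X" "X 0 = pos_orientation w"
        "s = 1 \<and> X 1 = pos_orientation v \<or> s = -1 \<and> X 1 = neg_orientation v"
      by blast
    then show "s = (if ?D (preferred_basis v) > 0 then 1 else -1)"
      using sign[OF gX(1-3)] by auto
  qed
qed

section \<open>Triangular matrices and the cells\<close>

text \<open>For \<open>R = (<)\<close> the index is that of the last nonzero coordinate, for
  \<open>R = (>)\<close> that of the first. Together with \<open>triangular\<close>, which means
  upper triangular for \<open>(<)\<close> and lower triangular for \<open>(>)\<close>, this treats
  both ends at once.\<close>

definition lead :: "('n \<Rightarrow> 'n \<Rightarrow> bool) \<Rightarrow> 'n::{finite,linorder} rvec \<Rightarrow> 'n \<Rightarrow> bool" where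
  "lead R x m \<longleftrightarrow> x $ m \<noteq> 0 \<and> (\<forall>j. R m j \<longrightarrow> x $ j = 0)"

definition triangular :: "('n \<Rightarrow> 'n \<Rightarrow> bool) \<Rightarrow> 'n::{finite,linorder} sqmat \<Rightarrow> bool" where
  "triangular R b \<longleftrightarrow> (\<forall>i j. R j i \<longrightarrow> b $ i $ j = 0) \<and> (\<forall>i. b $ i $ i > 0)"

lemma lead_exists:
  fixes x :: "'n::{finite,linorder} rvec"
  assumes "R = (<) \<or> R = (>)" "x \<noteq> 0"
  obtains m where "lead R x m"
proof -
  define S where "S = {m. x $ m \<noteq> 0}"
  have S: "finite S" "S \<noteq> {}"
    using assms(2) by (auto simp: S_def Finite_Cartesian_Product.vec_eq_iff)
  have x: "x $ m = 0 \<longleftrightarrow> m \<notin> S" for m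
    by (simp add: S_def)
  have "lead (<) x (Max S)" "lead (>) x (Min S)"
    using S by (auto simp: lead_def x not_le[symmetric])
  then show thesis using assms(1) that by blast
qed

lemma lead_unique:
  assumes "R = (<) \<or> R = (>)" "lead R x m" "lead R x n"
  shows "m = n"
  using assms by (auto simp: lead_def) (metis linorder_neqE)+

lemma lead_triangular_mult:
  assumes "R = (<) \<or> R = (>)" "triangular R b" "lead R x m"
  shows "(b *v x) $ m = b $ m $ m * x $ m" "lead R (b *v x) m"
proof -
  have zero: "b $ i $ j * x $ j = 0" if "i = m \<or> R m i" "j \<noteq> m \<or> i \<noteq> m" for i j
    using that assms by (auto simp: triangular_def lead_def) (metis linorder_neqE order.strict_trans)+
  have "(b *v x) $ m = (\<Sum>j\<in>UNIV. b $ m $ j * x $ j)"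
    by (simp add: matrix_vector_mult_def)
  also have "\<dots> = (\<Sum>j\<in>UNIV. if j = m then b $ m $ m * x $ m else 0)"
    using zero[of m] by (intro sum.cong) auto
  finally show *: "(b *v x) $ m = b $ m $ m * x $ m" by simp
  have "(b *v x) $ i = 0" if "R m i" for i
  proof -
    have "i \<noteq> m" using that assms(1) by auto
    then have "b $ i $ j * x $ j = 0" for j using zero[of i j] that by blast
    then show ?thesis by (simp only: matrix_vector_mult_def vec_lambda_beta sum.neutral_const)
  qed
  moreover have "b $ m $ m * x $ m \<noteq> 0"
    using assms(2,3) by (auto simp: triangular_def lead_def less_le)
  ultimately show "lead R (b *v x) m" by (auto simp: lead_def *)
qed

lemma lead_triangular_mult_iff:
  assumes "R = (<) \<or> R = (>)" "triangular R b"
  shows "lead R (b *v x) m \<longleftrightarrow> lead R x m"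
proof
  assume l: "lead R (b *v x) m"
  then have "x \<noteq> 0" by (auto simp: lead_def)
  then obtain n where "lead R x n" using lead_exists[OF assms(1)] by blast
  then show "lead R x m"
    using lead_triangular_mult(2)[OF assms] lead_unique[OF assms(1) l] by metis
qed (rule lead_triangular_mult(2)[OF assms])

lemma invertible_triangular:
  assumes "R = (<) \<or> R = (>)" "triangular R b"
  shows "invertible b"
proof -
  have "x = 0" if "b *v x = 0" for x
  proof (rule ccontr)
    assume "x \<noteq> 0"
    then obtain m where "lead R x m" using lead_exists[OF assms(1)] by blast
    then show False
      using lead_triangular_mult(2)[OF assms, of x m] that by (simp add: lead_def)
  qed
  then show ?thesis
    by (meson invertible_left_inverse matrix_left_invertible_ker)
qed

lemma Bplus_iff_triangular: "b \<in> Bplus \<longleftrightarrow> triangular (<) b"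
  using invertible_triangular[of "(<)" b] by (auto simp: Bplus_def triangular_def)

text \<open>Column j of the inverse is mapped to \<open>axis j 1\<close>. Triangular matrices
  preserve leading positions, so this column leads at j, with diagonal entry the inverse of
  \<open>b $ j $ j\<close>.\<close>

lemma Bplus_inverse:
  assumes "b \<in> Bplus"
  obtains c where "c \<in> Bplus" "b ** c = mat 1" "c ** b = mat 1"
proof -
  have b: "triangular (<) b" using assms by (simp add: Bplus_iff_triangular)
  obtain c where c: "b ** c = mat 1" "c ** b = mat 1"
    using assms by (auto simp: Bplus_def invertible_def)
  have col: "lead (<) (c *v axis j 1) j \<and> b $ j $ j * (c *v axis j 1) $ j = 1" for j
  proof -
    have e: "b *v (c *v axis j 1) = axis j 1"
      by (simp add: matrix_vector_mul_assoc c)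
    have "lead (<) (axis j 1 :: 'a rvec) j"
      by (auto simp: lead_def axis_def)
    then have l: "lead (<) (c *v axis j 1) j"
      using lead_triangular_mult_iff[OF _ b, of "c *v axis j 1" j] e by simp
    show ?thesis
      using lead_triangular_mult(1)[OF _ b l] l by (simp add: e)
  qed
  have "triangular (<) c"
    unfolding triangular_def
  proof (intro conjI allI impI)
    fix i j :: 'a assume "j < i"
    then show "c $ i $ j = 0"
      using col[of j] by (simp add: lead_def matrix_vector_mult_basis column_def)
  next
    fix j
    have "b $ j $ j * c $ j $ j = 1" "b $ j $ j > 0"
      using col[of j] b by (auto simp: matrix_vector_mult_basis column_def triangular_def)
    then show "c $ j $ j > 0"
      using zero_less_mult_pos[of "b $ j $ j" "c $ j $ j"] by simp
  qed
  then show thesis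
    using that c by (simp add: Bplus_iff_triangular)
qed

text \<open>Triangular factors keep the leading position, so both b' y and w (b' y) lead at m. But w
  moves the entry at m to position j, which therefore cannot lie beyond m; if j = m, comparing the
  entries at m gives a positive multiple of \<open>w $ m $ m\<close> equal to -1.\<close>

lemma lead_neg_eigenvector:
  assumes R: "R = (<) \<or> R = (>)" and b: "triangular R b" "triangular R b'"
    and y: "(b ** w ** b') *v y = - y" "lead R y m"
    and w: "w $ j $ m \<noteq> 0" "\<And>i. i \<noteq> m \<Longrightarrow> w $ j $ i = 0"
  shows "\<not> R m j" "j = m \<Longrightarrow> w $ m $ m < 0"
proof -
  let ?z = "b' *v y" and ?u = "w *v (b' *v y)"
  have z: "lead R ?z m" "?z $ m = b' $ m $ m * y $ m"
    using lead_triangular_mult[OF R b(2) y(2)] by auto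
  have bu: "b *v ?u = - y"
    using y(1) by (simp add: matrix_vector_mul_assoc matrix_mul_assoc)
  have "lead R (- y) m" using y(2) by (simp add: lead_def)
  then have u: "lead R ?u m"
    using lead_triangular_mult_iff[OF R b(1), of ?u m] bu by simp
  have "?u $ j = (\<Sum>i\<in>UNIV. w $ j $ i * ?z $ i)"
    by (simp add: matrix_vector_mult_def[of w])
  also have "\<dots> = (\<Sum>i\<in>UNIV. if i = m then w $ j $ m * ?z $ m else 0)"
    using w(2) by (intro sum.cong) auto
  finally have uj: "?u $ j = w $ j $ m * ?z $ m" by simp
  then have "?u $ j \<noteq> 0"
    using w(1) z(1) by (simp add: lead_def)
  then show "\<not> R m j" using u by (auto simp: lead_def)
  assume "j = m"
  then have "b $ m $ m * (w $ m $ m * (b' $ m $ m * y $ m)) = - y $ m"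
    using lead_triangular_mult(1)[OF R b(1) u] bu uj z(2) by simp
  then have "((b $ m $ m * b' $ m $ m) * w $ m $ m) * y $ m = - 1 * y $ m"
    by (simp add: algebra_simps)
  then have "(b $ m $ m * b' $ m $ m) * w $ m $ m = - 1"
    using y(2) unfolding lead_def by (metis mult_right_cancel)
  moreover have "b $ m $ m * b' $ m $ m > 0"
    using b by (simp add: triangular_def)
  ultimately show "w $ m $ m < 0"
    using mult_nonneg_nonneg[of "b $ m $ m * b' $ m $ m" "w $ m $ m"] by linarith
qed

text \<open>Elements of the cell are symmetric, so transposing the decomposition gives one with
  lower triangular factors and the same \<open>w\<close>. This yields the statements about first
  nonzero coordinates.\<close>

lemma cell_decomposition:
  assumes "h \<in> cell w" "Finite_Cartesian_Product.transpose w = w" "R = (<) \<or> R = (>)"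
  obtains b b' where "triangular R b" "triangular R b'" "h = b ** w ** b'"
proof -
  obtain b b' where b: "triangular (<) b" "triangular (<) b'" "h = b ** w ** b'"
    using assms(1) by (auto simp: cell_def Bplus_iff_triangular)
  show thesis
    using assms(3)
  proof
    assume "R = (<)"
    then show thesis using b that by simp
  next
    assume R: "R = (>)"
    have "h = Finite_Cartesian_Product.transpose h"
      using assms(1) Gk_symmetric[of h "neg_index w"] by (simp add: cell_def)
    also have "\<dots> = Finite_Cartesian_Product.transpose b' ** w ** Finite_Cartesian_Product.transpose b"
      using b(3) assms(2) by (simp add: matrix_transpose_mul matrix_mul_assoc)
    finally show thesis
      using b(1,2) by (intro that) (auto simp: R triangular_def Finite_Cartesian_Product.transpose_def)
  qed
qed

lemma transversal_cell:
  assumes h: "h \<in> cell w" and w: "Finite_Cartesian_Product.transpose w = w"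
    and R: "R = (<) \<or> R = (>)"
    and m: "\<And>m. (\<exists>c. c \<noteq> 0 \<and> c *\<^sub>R axis m 1 \<in> set xs) \<or>
      (\<exists>j. w $ j $ m \<noteq> 0 \<and> (\<forall>i. i \<noteq> m \<longrightarrow> w $ j $ i = 0) \<and> (R m j \<or> j = m \<and> w $ m $ m > 0))"
  shows "transversal (neg_eigenspace h) xs"
  unfolding transversal_def
proof (intro ballI impI, rule ccontr)
  fix y assume y: "y \<in> neg_eigenspace h" "\<forall>x\<in>set xs. x \<bullet> y = 0" "y \<noteq> 0"
  obtain n where n: "lead R y n" using lead_exists[OF R y(3)] by blast
  obtain b b' where b: "triangular R b" "triangular R b'" "h = b ** w ** b'"
    using cell_decomposition[OF h w R] by blast
  from m[of n] show False
  proof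
    assume "\<exists>c. c \<noteq> 0 \<and> c *\<^sub>R axis n 1 \<in> set xs"
    then show False using y(2) n by (auto simp: lead_def inner_axis')
  next
    assume "\<exists>j. w $ j $ n \<noteq> 0 \<and> (\<forall>i. i \<noteq> n \<longrightarrow> w $ j $ i = 0) \<and> (R n j \<or> j = n \<and> w $ n $ n > 0)"
    then show False
      using lead_neg_eigenvector[OF R b(1,2), of w y n] y(1) n b(3)
      by (auto simp: neg_eigenspace_def)
  qed
qed

section \<open>Membership in a cell\<close>

lemma neg_index_eq:
  fixes w :: "'n::{finite,linorder} sqmat"
  assumes "trace w = real CARD('n) - 2 * real k"
  shows "neg_index w = k"
  unfolding neg_index_def using assms by (intro the_equality) auto

text \<open>Conjugation by a single \<open>b\<close>, rather than two independent triangular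
  factors, passes the involution property and the trace on from \<open>w\<close>; with symmetry,
  orthogonality follows.\<close>

lemma cell_memI:
  fixes g w :: "'n::{finite,linorder} sqmat"
  assumes w: "w ** w = mat 1" "trace w = real CARD('n) - 2 * real k"
    and g: "Finite_Cartesian_Product.transpose g = g"
    and b: "triangular (<) b" "g ** b = b ** w"
  shows "g \<in> cell w" "g \<in> Gk k"
proof -
  have "b \<in> Bplus" using b(1) by (simp add: Bplus_iff_triangular)
  then obtain c where c: "c \<in> Bplus" "b ** c = mat 1" "c ** b = mat 1"
    using Bplus_inverse by blast
  have "g = g ** (b ** c)" by (simp add: c(2))
  also have "\<dots> = b ** w ** c" by (simp add: b(2) matrix_mul_assoc)
  finally have gb: "g = b ** w ** c" .
  have "g ** g = g ** b ** w ** c"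
    by (subst (2) gb) (simp add: matrix_mul_assoc)
  also have "\<dots> = b ** (w ** w) ** c"
    by (simp add: b(2) matrix_mul_assoc)
  finally have gg: "g ** g = mat 1"
    by (simp add: w(1) c(2))
  have "trace g = trace (c ** (b ** w))"
    unfolding gb by (rule trace_mul_sym)
  also have "\<dots> = trace w" by (simp add: matrix_mul_assoc c(3))
  finally show "g \<in> Gk k"
    using gg g w(2) by (simp add: Gk_def orthogonal_matrix)
  then show "g \<in> cell w"
    using \<open>b \<in> Bplus\<close> c(1) gb neg_index_eq[OF w(2)] by (auto simp: cell_def)
qed

section \<open>Coordinates\<close>

lemma sorted_list_of_UNIV_eq:
  "sorted_list_of_set (UNIV :: 'n::{finite,linorder} set) = map ix [1..<Suc CARD('n)]"
  by (rule nth_equalityI) (auto simp: ix_def simp del: upt_Suc)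

lemma ix_less_iff:
  assumes "1 \<le> a" "a \<le> CARD('n)" "1 \<le> b" "b \<le> CARD('n)"
  shows "(ix a :: 'n::{finite,linorder}) < ix b \<longleftrightarrow> a < b"
proof -
  have "(ix a :: 'n) < ix b" if "a < b" "1 \<le> a" "b \<le> CARD('n)" for a b
    using sorted_wrt_nth_less[OF strict_sorted_list_of_set, of "a - 1" "b - 1" "UNIV :: 'n set"] that
    by (simp add: ix_def)
  then show ?thesis using assms by (metis less_asym linorder_neqE_nat less_irrefl)
qed

lemma ix_eq_iff:
  assumes "1 \<le> a" "a \<le> CARD('n)" "1 \<le> b" "b \<le> CARD('n)"
  shows "(ix a :: 'n::{finite,linorder}) = ix b \<longleftrightarrow> a = b"
  using ix_less_iff[OF assms] ix_less_iff[OF assms(3,4,1,2)] by (metis less_irrefl linorder_neqE_nat)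

lemma ix_le_iff:
  assumes "1 \<le> a" "a \<le> CARD('n)" "1 \<le> b" "b \<le> CARD('n)"
  shows "(ix a :: 'n::{finite,linorder}) \<le> ix b \<longleftrightarrow> a \<le> b"
  using ix_less_iff[OF assms(3,4,1,2)] by (simp flip: not_less)

lemma UNIV_eq_ix: "(UNIV :: 'n::{finite,linorder} set) = ix ` {1..CARD('n)}"
proof -
  have "(UNIV :: 'n set) = set (sorted_list_of_set UNIV)" by simp
  also have "\<dots> = ix ` {1..<Suc CARD('n)}"
    unfolding sorted_list_of_UNIV_eq by (simp only: set_map set_upt)
  finally show ?thesis by (simp add: atLeastLessThanSuc_atLeastAtMost)
qed

lemma all_ix_iff: "(\<forall>i :: 'n::{finite,linorder}. P i) \<longleftrightarrow> (\<forall>a\<in>{1..CARD('n)}. P (ix a))"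
  using UNIV_eq_ix[where 'n = 'n] by (metis UNIV_I image_iff)

lemma sum_UNIV_ix: "(\<Sum>i\<in>(UNIV :: 'n::{finite,linorder} set). f i) = (\<Sum>a=1..CARD('n). f (ix a))"
  using sum.reindex[of "ix :: nat \<Rightarrow> 'n" "{1..CARD('n)}" f] UNIV_eq_ix[where 'n = 'n]
  by (simp add: inj_on_def ix_eq_iff)

text \<open>The number of smaller elements is the position counted from 0, while \<open>ix\<close>
  counts from 1; hence the shift by one in \<open>of_rows_nth\<close>.\<close>

definition of_rows :: "real list list \<Rightarrow> 'n::{finite,linorder} sqmat" where
  "of_rows M = (\<chi> i j. M ! card {k. k < i} ! card {k. k < j})"

lemma card_less_ix:
  assumes "1 \<le> a" "a \<le> CARD('n)"
  shows "card {k. k < (ix a :: 'n::{finite,linorder})} = a - 1"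
proof -
  have "{k. k < (ix a :: 'n)} = ix ` {1..<a}"
  proof (rule subset_antisym; rule subsetI)
    fix k :: 'n assume k: "k \<in> {k. k < ix a}"
    obtain b where "k = ix b" "b \<in> {1..CARD('n)}" using UNIV_eq_ix by blast
    then show "k \<in> ix ` {1..<a}" using k assms by (auto simp: ix_less_iff)
  qed (use assms in \<open>auto simp: ix_less_iff\<close>)
  moreover have "inj_on (ix :: nat \<Rightarrow> 'n) {1..<a}"
    using assms by (auto simp: inj_on_def ix_eq_iff)
  ultimately show ?thesis by (simp add: card_image)
qed

lemma of_rows_nth:
  assumes "1 \<le> a" "a \<le> CARD('n)" "1 \<le> b" "b \<le> CARD('n)"
  shows "(of_rows M :: 'n::{finite,linorder} sqmat) $ ix a $ ix b = M ! (a - 1) ! (b - 1)"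
  using assms by (simp add: of_rows_def card_less_ix)

lemma continuous_on_of_rows:
  assumes "\<And>a b. \<lbrakk>a < CARD('n); b < CARD('n)\<rbrakk> \<Longrightarrow> continuous_on S (\<lambda>t. M t ! a ! b)"
  shows "continuous_on S (\<lambda>t. of_rows (M t) :: 'n::{finite,linorder} sqmat)"
proof -
  have "card {k. k < i} < CARD('n)" for i :: 'n
    by (rule psubset_card_mono) auto
  then show ?thesis
    unfolding of_rows_def using assms by (intro continuous_on_vec_lambda) simp
qed

section \<open>Signed involutions\<close>

text \<open>Applying \<open>A\<close> twice to a basis vector gives p (p i) = i and s i * s (p i) =
  1. The two signs on a 2-cycle thus agree, which is also why \<open>A\<close> is symmetric.\<close>

lemma signed_involution_under_perm:
  assumes "signed_involution A"
  shows "A $ j $ i = (if j = under_perm A i then entry_sign A i else 0)"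
    and "entry_sign A i \<in> {1, -1}"
    and "entry_sign A (under_perm A i) = entry_sign A i"
    and "Finite_Cartesian_Product.transpose A = A"
proof -
  obtain p s where ps: "\<And>i. s i \<in> {1, -1 :: real}" "\<And>i. A *v axis i 1 = s i *\<^sub>R axis (p i) 1"
    using assms by (auto simp: signed_involution_def signed_perm_matrix_def)
  have e: "A $ j $ i = (if j = p i then s i else 0)" for i j
  proof -
    have "A $ j $ i = (A *v axis i 1) $ j"
      by (simp add: matrix_vector_mult_basis column_def)
    then show ?thesis unfolding ps(2) by (simp add: axis_def)
  qed
  have s0: "s i \<noteq> 0" for i using ps(1)[of i] by auto
  have p: "under_perm A i = p i" for i
    unfolding under_perm_def using s0 by (auto simp: e)
  have es: "entry_sign A i = s i" for i
    by (simp add: entry_sign_def p e)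
  show A: "A $ j $ i = (if j = under_perm A i then entry_sign A i else 0)" for i j
    by (simp add: e p es)
  show "entry_sign A i \<in> {1, -1}" for i
    using ps(1) by (simp add: es)
  have inv: "(s i * s (p i)) *\<^sub>R axis (p (p i)) 1 = (axis i 1 :: 'a rvec)" for i
  proof -
    have "A *v (A *v axis i 1) = axis i 1"
      using assms by (simp add: signed_involution_def matrix_vector_mul_assoc)
    then show ?thesis by (simp add: ps(2) matrix_vector_mult_scaleR)
  qed
  have inv': "(s i * s (p i)) * (if p (p i) = i then 1 else 0) = 1" for i
    using arg_cong[OF inv[of i], of "\<lambda>x. x $ i"] by (auto simp: axis_def split: if_splits)
  then have pp: "p (p i) = i" for i
    by (metis mult_zero_right zero_neq_one)
  have ss: "s i * s (p i) = 1" for i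
    using inv'[of i] by (simp add: pp)
  have sp: "s (p i) = s i" for i
    using ss[of i] ps(1)[of i] by auto
  then show "entry_sign A (under_perm A i) = entry_sign A i" for i
    by (simp add: es p)
  have "A $ i $ j = A $ j $ i" for i j
    by (metis e pp sp)
  then show "Finite_Cartesian_Product.transpose A = A"
    by (simp add: Finite_Cartesian_Product.vec_eq_iff Finite_Cartesian_Product.transpose_def)
qed

section \<open>The model rises\<close>

text \<open>Sizes 1 and 2 suffice: these are the dimensions of the (-1)-eigenspaces in the model
  rises.\<close>

lemma frame_det_1: "frame_det [x] [b] = x \<bullet> b"
  unfolding frame_det_def by (subst det_single) auto

lemma frame_det_2: "frame_det [x, y] [b, c] = (x \<bullet> b) * (y \<bullet> c) - (x \<bullet> c) * (y \<bullet> b)"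
proof -
  let ?t = "Transposition.transpose 0 (1 :: nat)"
  let ?M = "Matrix.mat 2 2 (\<lambda>(i, j). [x, y] ! i \<bullet> [b, c] ! j)"
  have "{0..<2} = {0, 1 :: nat}" by auto
  then have P: "{p. p permutes {0..<2}} = {id, ?t}"
    by (auto simp: permutes_doubleton_iff)
  have ne: "id \<noteq> ?t"
    by (metis id_apply transpose_apply_first zero_neq_one)
  have "frame_det [x, y] [b, c] = Determinant.det ?M"
    by (simp add: frame_det_def numeral_2_eq_2)
  also have "\<dots> = (\<Sum>p\<in>{id, ?t}. signof p * (\<Prod>i = 0..<2. ?M $$ (i, p i)))"
    unfolding P[symmetric] by (rule det_def') simp
  also have "\<dots> = (\<Sum>p\<in>{id, ?t}. signof p * (?M $$ (0, p 0) * ?M $$ (1, p 1)))"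
    by (simp only: numeral_2_eq_2 prod.atLeast0_lessThan_Suc) simp
  also have "\<dots> = (x \<bullet> b) * (y \<bullet> c) - (x \<bullet> c) * (y \<bullet> b)"
    using ne by (simp add: sign_swap_id)
  finally show ?thesis .
qed

text \<open>The conjugating matrix is requested for t < 1 only: in the paths below, diagonal entries
  of \<open>b t\<close> tend to 0 as the path leaves the cell at \<open>v\<close>.\<close>

lemma orient_sign_via_path:
  fixes v w :: "'n::{finite,linorder} sqmat" and g :: "real \<Rightarrow> 'n sqmat"
  assumes v: "signed_involution v" and w: "signed_involution w"
    and tr: "trace v = real CARD('n) - 2 * real (length xs)"
      "trace w = real CARD('n) - 2 * real (length xs)"
    and g: "continuous_on {0..1} g" "g 0 = w" "g 1 = v"
    and b: "\<And>t. \<lbrakk>0 \<le> t; t < 1\<rbrakk> \<Longrightarrow> Finite_Cartesian_Product.transpose (g t) = g t"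
      "\<And>t. \<lbrakk>0 \<le> t; t < 1\<rbrakk> \<Longrightarrow> triangular (<) (b t)"
      "\<And>t. \<lbrakk>0 \<le> t; t < 1\<rbrakk> \<Longrightarrow> g t ** b t = b t ** w"
    and xs: "\<And>h. h \<in> cell w \<Longrightarrow> transversal (neg_eigenspace h) xs"
      "transversal (neg_eigenspace v) xs"
    and D: "length (preferred_basis w) = length xs" "frame_det xs (preferred_basis w) > 0"
      "frame_det xs (map (neg_projection w) xs) > 0"
      "length (preferred_basis v) = length xs" "frame_det xs (preferred_basis v) \<noteq> 0"
  shows "orient_sign v w = (if frame_det xs (preferred_basis v) > 0 then 1 else -1)"
proof -
  have k: "neg_index w = length xs" using neg_index_eq[OF tr(2)] .
  have ww: "w ** w = mat 1" and vv: "v ** v = mat 1"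
    using v w by (auto simp: signed_involution_def)
  have cell: "g t \<in> cell w" "g t \<in> Gk (length xs)" if "0 \<le> t" "t < 1" for t
    using cell_memI[OF ww tr(2) b(1-3)] that by auto
  have "v \<in> Gk (length xs)"
    using vv tr(1) signed_involution_under_perm(4)[OF v] by (simp add: Gk_def orthogonal_matrix)
  then have "path_image g \<subseteq> Gk (length xs)"
    using cell(2) g(3) by (auto simp: path_image_def) (metis order_le_less)
  then have "cell_path v w g"
    using g cell(1) by (simp add: cell_path_def path_def pathstart_def pathfinish_def k)
  then show ?thesis
    using xs by (intro orient_sign_eq_frame_det[OF _ k _ D]) auto
qed

section \<open>Signed coordinate frames\<close>

lemma axis_nth_if: "axis i x $ j = (if j = i then x else 0)"
  by (simp add: axis_def)

definition axis_frame :: "(real \<times> 'n::{finite,linorder}) list \<Rightarrow> 'n rvec list" where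
  "axis_frame cms = map (\<lambda>(c, m). c *\<^sub>R axis m 1) cms"

lemma axis_frame_orthogonal_nth:
  assumes "\<forall>(c, m)\<in>set cms. c \<noteq> 0" "\<forall>x\<in>set (axis_frame cms). x \<bullet> y = 0" "m \<in> snd ` set cms"
  shows "y $ m = 0"
  using assms by (force simp: axis_frame_def inner_axis')

lemma signed_involution_axis:
  assumes "signed_involution A"
  shows "A *v axis i 1 = entry_sign A i *\<^sub>R axis (under_perm A i) 1"
  by (simp add: Finite_Cartesian_Product.vec_eq_iff matrix_vector_mult_basis column_def axis_nth_if
      signed_involution_under_perm(1)[OF assms])

lemma neg_projection_axis_frame:
  assumes "signed_involution A"
  shows "map (neg_projection A) (axis_frame cms) =
    map (\<lambda>(c, m). (c / 2) *\<^sub>R (axis m 1 - entry_sign A m *\<^sub>R axis (under_perm A m) 1)) cms"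
  by (simp add: axis_frame_def neg_projection_def matrix_vector_mult_scaleR
      signed_involution_axis[OF assms] scaleR_diff_right mult.commute split: prod.splits)

lemma axis_diff_eq_0_iff: "axis i 1 - s *\<^sub>R axis j 1 = (0 :: 'n::finite rvec) \<longleftrightarrow> i = j \<and> s = 1"
proof
  assume "axis i 1 - s *\<^sub>R axis j 1 = (0 :: 'n rvec)"
  then have "(axis i 1 - s *\<^sub>R axis j 1) $ i = (0 :: real)" by simp
  then show "i = j \<and> s = 1" by (auto simp: axis_nth_if split: if_splits)
qed simp

lemma preferred_basis_eq:
  fixes A :: "'n::{finite,linorder} sqmat"
  assumes "signed_involution A"
  shows "preferred_basis A =
    map (\<lambda>i. axis i 1 - entry_sign A i *\<^sub>R axis (under_perm A i) 1)
      (filter (\<lambda>i. i \<le> under_perm A i \<and> \<not> (under_perm A i = i \<and> entry_sign A i = 1))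
        (map ix [1..<Suc CARD('n)]))"
proof -
  have ne: "axis i 1 - entry_sign A i *\<^sub>R axis (under_perm A i) 1 \<noteq> (0 :: 'n rvec) \<longleftrightarrow>
      \<not> (under_perm A i = i \<and> entry_sign A i = 1)" for i
    using axis_diff_eq_0_iff[of i "entry_sign A i" "under_perm A i"] by auto
  show ?thesis
    unfolding preferred_basis_def signed_involution_axis[OF assms] sorted_list_of_UNIV_eq
      filter_map comp_def filter_filter ne
    by (simp add: conj_commute)
qed

lemma transversal_cell_axis_frame:
  assumes w: "signed_involution w" and h: "h \<in> cell w" and R: "R = (<) \<or> R = (>)"
    and c: "\<forall>(c, m)\<in>set cms. c \<noteq> 0"
    and m: "\<forall>m. m \<in> snd ` set cms \<or> R m (under_perm w m) \<or>
      under_perm w m = m \<and> entry_sign w m = 1"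
  shows "transversal (neg_eigenspace h) (axis_frame cms)"
proof (rule transversal_cell[OF h signed_involution_under_perm(4)[OF w] R])
  fix m
  note e = signed_involution_under_perm[OF w]
  show "(\<exists>c. c \<noteq> 0 \<and> c *\<^sub>R axis m 1 \<in> set (axis_frame cms)) \<or>
      (\<exists>j. w $ j $ m \<noteq> 0 \<and> (\<forall>i. i \<noteq> m \<longrightarrow> w $ j $ i = 0) \<and> (R m j \<or> j = m \<and> w $ m $ m > 0))"
  proof (cases "m \<in> snd ` set cms")
    case True
    then show ?thesis using c by (force simp: axis_frame_def)
  next
    case False
    have sym: "w $ i $ j = w $ j $ i" for i j
      using arg_cong[OF e(4), of "\<lambda>A. A $ i $ j"] by (simp add: Finite_Cartesian_Product.transpose_def)
    \<comment> \<open>Columns have one nonzero entry by definition of \<open>under_perm\<close>;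
      symmetry carries this over to rows.\<close>
    have row: "w $ under_perm w m $ i = 0" if "i \<noteq> m" for i
    proof -
      have "w $ under_perm w m $ i = w $ i $ under_perm w m" by (rule sym)
      moreover have "w $ m $ under_perm w m \<noteq> 0"
        using sym[of m "under_perm w m"] e(1)[of "under_perm w m" m] e(2)[of m] by auto
      ultimately show ?thesis using that e(1) by metis
    qed
    have "w $ under_perm w m $ m = entry_sign w m" "entry_sign w m \<noteq> 0"
      using e(1)[of "under_perm w m" m] e(2)[of m] by auto
    then show ?thesis
      using m[rule_format, of m] False row by (intro disjI2 exI[of _ "under_perm w m"]) auto
  qed
qed

text \<open>A (-1)-eigenvector of \<open>v\<close> has coordinates related by a sign along each
  2-cycle, so one coordinate per cycle is enough; a coordinate fixed with sign +1 vanishes by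
  itself.\<close>

lemma transversal_axis_frame:
  assumes v: "signed_involution v" and c: "\<forall>(c, m)\<in>set cms. c \<noteq> 0"
    and m: "\<forall>m. m \<in> snd ` set cms \<or> under_perm v m \<in> snd ` set cms \<or>
      under_perm v m = m \<and> entry_sign v m = 1"
  shows "transversal (neg_eigenspace v) (axis_frame cms)"
  unfolding transversal_def
proof (intro ballI impI)
  fix y assume y: "y \<in> neg_eigenspace v" "\<forall>x\<in>set (axis_frame cms). x \<bullet> y = 0"
  have "y $ m = 0" for m
  proof -
    note e = signed_involution_under_perm[OF v]
    have "- y $ m = - (y \<bullet> axis m 1)" by (simp add: inner_axis)
    also have "\<dots> = (v *v y) \<bullet> axis m 1" using y(1) by (simp add: neg_eigenspace_def)
    also have "\<dots> = y \<bullet> (v *v axis m 1)"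
      using e(4) by (metis dot_lmul_matrix vector_transpose_matrix)
    also have "\<dots> = entry_sign v m * y $ under_perm v m"
      by (simp add: signed_involution_axis[OF v] inner_axis)
    finally have *: "- y $ m = entry_sign v m * y $ under_perm v m" .
    from m have "m \<in> snd ` set cms \<or> under_perm v m \<in> snd ` set cms \<or>
        under_perm v m = m \<and> entry_sign v m = 1" by blast
    then show ?thesis
    proof (elim disjE)
      assume "under_perm v m \<in> snd ` set cms"
      then show ?thesis
        using axis_frame_orthogonal_nth[OF c y(2)] * by simp
    qed (use axis_frame_orthogonal_nth[OF c y(2)] * in simp_all)
  qed
  then show "y = 0" by (simp add: Finite_Cartesian_Product.vec_eq_iff)
qed

lemma sqrt_one_minus_square:
  assumes "0 \<le> t" "t < 1"
  shows "sqrt (1 - t * t) * sqrt (1 - t * t) = 1 - t * t" "sqrt (1 - t * t) > 0"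
proof -
  have "t * t < 1" using mult_strict_mono[of t 1 t 1] assms by simp
  then show "sqrt (1 - t * t) * sqrt (1 - t * t) = 1 - t * t" "sqrt (1 - t * t) > 0" by simp_all
qed

text \<open>Lets the simplifier use a known square inside right-nested products, as produced by
  \<open>algebra_simps\<close>.\<close>

lemma square_absorb: "x * x = r \<Longrightarrow> x * (x * z) = r * (z :: real)"
  by (metis mult.assoc)

section \<open>Explicit indices for d = 2, 3, 4\<close>

lemma all_ix_2:
  assumes "CARD('n) = 2"
  shows "(\<forall>i :: 'n::{finite,linorder}. P i) \<longleftrightarrow> P (ix 1) \<and> P (ix 2)"
proof -
  have "{1..2} = {1, 2 :: nat}" by auto
  then show ?thesis unfolding all_ix_iff assms by simp
qed

lemma sum_ix_2:
  assumes "CARD('n) = 2"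
  shows "(\<Sum>i\<in>(UNIV :: 'n::{finite,linorder} set). f i) = f (ix 1) + f (ix 2)"
  unfolding sum_UNIV_ix assms by (simp add: numeral_eq_Suc)

lemma ix_list_2:
  assumes "CARD('n) = 2"
  shows "map ix [1..<Suc CARD('n)] = [ix 1, ix 2 :: 'n::{finite,linorder}]"
  unfolding assms by (simp add: numeral_eq_Suc)

lemma matrix_eq_2:
  fixes A B :: "'n::{finite,linorder} sqmat"
  assumes "CARD('n) = 2"
  shows "A = B \<longleftrightarrow> (\<forall>a\<in>{1, 2}. \<forall>b\<in>{1, 2}. A $ ix a $ ix b = B $ ix a $ ix b)"
  by (simp add: Finite_Cartesian_Product.vec_eq_iff all_ix_2[OF assms])

lemma all_ix_3:
  assumes "CARD('n) = 3"
  shows "(\<forall>i :: 'n::{finite,linorder}. P i) \<longleftrightarrow> P (ix 1) \<and> P (ix 2) \<and> P (ix 3)"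
proof -
  have "{1..3} = {1, 2, 3 :: nat}" by auto
  then show ?thesis unfolding all_ix_iff assms by simp
qed

lemma sum_ix_3:
  assumes "CARD('n) = 3"
  shows "(\<Sum>i\<in>(UNIV :: 'n::{finite,linorder} set). f i) = f (ix 1) + f (ix 2) + f (ix 3)"
  unfolding sum_UNIV_ix assms by (simp add: numeral_eq_Suc)

lemma ix_list_3:
  assumes "CARD('n) = 3"
  shows "map ix [1..<Suc CARD('n)] = [ix 1, ix 2, ix 3 :: 'n::{finite,linorder}]"
  unfolding assms by (simp add: numeral_eq_Suc)

lemma matrix_eq_3:
  fixes A B :: "'n::{finite,linorder} sqmat"
  assumes "CARD('n) = 3"
  shows "A = B \<longleftrightarrow> (\<forall>a\<in>{1, 2, 3}. \<forall>b\<in>{1, 2, 3}. A $ ix a $ ix b = B $ ix a $ ix b)"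
  by (simp add: Finite_Cartesian_Product.vec_eq_iff all_ix_3[OF assms])

lemma all_ix_4:
  assumes "CARD('n) = 4"
  shows "(\<forall>i :: 'n::{finite,linorder}. P i) \<longleftrightarrow> P (ix 1) \<and> P (ix 2) \<and> P (ix 3) \<and> P (ix 4)"
proof -
  have "{1..4} = {1, 2, 3, 4 :: nat}" by auto
  then show ?thesis unfolding all_ix_iff assms by simp
qed

lemma sum_ix_4:
  assumes "CARD('n) = 4"
  shows "(\<Sum>i\<in>(UNIV :: 'n::{finite,linorder} set). f i) = f (ix 1) + f (ix 2) + f (ix 3) + f (ix 4)"
  unfolding sum_UNIV_ix assms by (simp add: numeral_eq_Suc)

lemma ix_list_4:
  assumes "CARD('n) = 4"
  shows "map ix [1..<Suc CARD('n)] = [ix 1, ix 2, ix 3, ix 4 :: 'n::{finite,linorder}]"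
  unfolding assms by (simp add: numeral_eq_Suc)

lemma matrix_eq_4:
  fixes A B :: "'n::{finite,linorder} sqmat"
  assumes "CARD('n) = 4"
  shows "A = B \<longleftrightarrow> (\<forall>a\<in>{1, 2, 3, 4}. \<forall>b\<in>{1, 2, 3, 4}. A $ ix a $ ix b = B $ ix a $ ix b)"
  by (simp add: Finite_Cartesian_Product.vec_eq_iff all_ix_4[OF assms])

text \<open>The eigenspace of \<open>v\<close> is a coordinate axis, the second for \<epsilon> = 1
  and the first for \<epsilon> = -1. The reference coordinate has to be that one.\<close>

lemma orient_sign_FF:
  fixes v w :: "'n::{finite,linorder} sqmat"
  assumes d: "CARD('n) = 2" and v: "signed_involution v" and w: "signed_involution w"
    and pv: "under_perm v = id"
    and pw: "under_perm w = Transposition.transpose (ix 1) (ix 2)"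
    and signs: "\<epsilon> \<in> {1, -1}" "s \<in> {1, -1}"
    and ev: "entry_sign v (ix 1) = \<epsilon>" "entry_sign v (ix 2) = - \<epsilon>"
    and ew: "entry_sign w (ix 1) = s"
  shows "orient_sign v w = (if \<epsilon> = 1 \<and> s = 1 then -1 else 1)"
proof -
  note co = d ix_eq_iff ix_less_iff ix_le_iff of_rows_nth sum_ix_2[OF d] all_ix_2[OF d]
    Transposition.transpose_def
  note up = signed_involution_under_perm
  have ew': "entry_sign w (ix 2) = s"
    using up(3)[OF w, of "ix 1"] ew by (simp_all add: pw co)
  have v_eq: "v = of_rows [[\<epsilon>, 0], [0, - \<epsilon>]]"
    unfolding matrix_eq_2[OF d] up(1)[OF v] pv using ev by (simp add: co)
  have w_eq: "w = of_rows [[0, s], [s, 0]]"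
    unfolding matrix_eq_2[OF d] up(1)[OF w] pw using ew ew' by (simp add: co)
  have sq: "\<epsilon> * \<epsilon> = 1" "s * s = 1"
    using signs by auto
  define y where "y t = sqrt (1 - t * t)" for t :: real
  define g :: "real \<Rightarrow> 'n sqmat" where
    "g t = of_rows
      [[\<epsilon> * t, s * y t],
       [s * y t, - \<epsilon> * t]]" for t
  \<comment> \<open>Reading g b = b w by columns: column w(m) of \<open>b\<close> is the sign of w
    at m times \<open>g\<close> applied to column m. With first column e_1, the column at w(1) must
    be s g e_1, here and in all later types.\<close>
  define b :: "real \<Rightarrow> 'n sqmat" where
    "b t = of_rows
      [[1, \<epsilon> * s * t],
       [0, y t]]" for t
  \<comment> \<open>The coefficient - s makes the product with e_1 - s e_2 equal to +1; such
    coefficients below have the same purpose.\<close>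
  define cms :: "(real \<times> 'n) list" where "cms = (if \<epsilon> = 1 then [(- s, ix 2)] else [(1, ix 1)])"
  have cms: "\<forall>(c, m)\<in>set cms. c \<noteq> 0"
    using signs by (auto simp: cms_def)
  have pbv: "preferred_basis v =
      (if \<epsilon> = 1 then [axis (ix 2) 1 - (- \<epsilon>) *\<^sub>R axis (ix 2) 1]
       else [axis (ix 1) 1 - \<epsilon> *\<^sub>R axis (ix 1) 1])"
    unfolding preferred_basis_eq[OF v] ix_list_2[OF d] pv using ev signs by (auto simp: co)
  have pbw: "preferred_basis w =
      [axis (ix 1) 1 - s *\<^sub>R axis (ix 2) 1]"
    unfolding preferred_basis_eq[OF w] ix_list_2[OF d] pw using ew ew' signs by (auto simp: co)
  have "orient_sign v w = (if frame_det (axis_frame cms) (preferred_basis v) > 0 then 1 else -1)"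
  proof (rule orient_sign_via_path[OF v w])
    show "trace v = real CARD('n) - 2 * real (length (axis_frame cms))"
      "trace w = real CARD('n) - 2 * real (length (axis_frame cms))"
      using signs by (auto simp: trace_def v_eq w_eq co cms_def axis_frame_def)
    show "continuous_on {0..1} g"
      unfolding g_def y_def
      by (intro continuous_on_of_rows)
        (auto simp: d numeral_eq_Suc less_Suc_eq intro!: continuous_intros)
    show "g 0 = w" "g 1 = v"
      by (simp_all add: g_def y_def w_eq v_eq)
    show "transversal (neg_eigenspace v) (axis_frame cms)"
      using ev signs by (intro transversal_axis_frame[OF v cms]) (auto simp: cms_def pv co)
  next
    fix t :: real assume t: "0 \<le> t" "t < 1"
    note y = sqrt_one_minus_square[OF t, folded y_def]
    show "Finite_Cartesian_Product.transpose (g t) = g t"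
      by (simp add: matrix_eq_2[OF d] Finite_Cartesian_Product.transpose_def g_def co)
    show "triangular (<) (b t)"
      using y(2) by (simp add: triangular_def b_def co)
    show "g t ** b t = b t ** w"
      unfolding matrix_eq_2[OF d]
      by (simp add: g_def b_def w_eq matrix_matrix_mult_def co)
        (simp add: algebra_simps sq sq[THEN square_absorb] y y(1)[THEN square_absorb])
  next
    fix h assume h: "h \<in> cell w"
    show "transversal (neg_eigenspace h) (axis_frame cms)"
      using ew ew' signs
      by (intro transversal_cell_axis_frame[OF w h _ cms, of "if \<epsilon> = 1 then (<) else (>)"])
        (auto simp: cms_def pw co)
  next
    show "frame_det (axis_frame cms) (map (neg_projection w) (axis_frame cms)) > 0"
      unfolding neg_projection_axis_frame[OF w] using ew ew' signs
      by (auto simp: cms_def axis_frame_def frame_det_1 frame_det_2 pw inner_axis' axis_nth_if co)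
  qed (use signs in \<open>auto simp: pbv pbw cms_def axis_frame_def frame_det_1 frame_det_2
      inner_axis' axis_nth_if co\<close>)
  then show ?thesis
    using signs
    by (auto simp: pbv cms_def axis_frame_def frame_det_1 frame_det_2 inner_axis' axis_nth_if co)
qed

text \<open>For \<epsilon> = 1 the eigenspace of \<open>v\<close> is spanned by e_2 - \<delta> e_3,
  visible in coordinate 3 but not 1; for \<epsilon> = -1 it also contains e_1, so {2, 3} fails and
  {1, 2} serves.\<close>

lemma orient_sign_FE:
  fixes v w :: "'n::{finite,linorder} sqmat"
  assumes d: "CARD('n) = 3" and v: "signed_involution v" and w: "signed_involution w"
    and pv: "under_perm v = Transposition.transpose (ix 2) (ix 3)"
    and pw: "under_perm w = Transposition.transpose (ix 1) (ix 3)"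
    and signs: "\<epsilon> \<in> {1, -1}" "\<delta> \<in> {1, -1}" "s \<in> {1, -1}"
    and ev: "entry_sign v (ix 1) = \<epsilon>" "entry_sign v (ix 2) = \<delta>"
    and ew: "entry_sign w (ix 1) = s" "entry_sign w (ix 2) = \<epsilon>"
  shows "orient_sign v w = (if \<epsilon> = 1 \<and> \<delta> * s = -1 then -1 else 1)"
proof -
  note co = d ix_eq_iff ix_less_iff ix_le_iff of_rows_nth sum_ix_3[OF d] all_ix_3[OF d]
    Transposition.transpose_def
  note up = signed_involution_under_perm
  have ev': "entry_sign v (ix 3) = \<delta>"
    using up(3)[OF v, of "ix 2"] ev by (simp_all add: pv co)
  have ew': "entry_sign w (ix 3) = s"
    using up(3)[OF w, of "ix 1"] ew by (simp_all add: pw co)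
  have v_eq: "v = of_rows [[\<epsilon>, 0, 0], [0, 0, \<delta>], [0, \<delta>, 0]]"
    unfolding matrix_eq_3[OF d] up(1)[OF v] pv using ev ev' by (simp add: co)
  have w_eq: "w = of_rows [[0, 0, s], [0, \<epsilon>, 0], [s, 0, 0]]"
    unfolding matrix_eq_3[OF d] up(1)[OF w] pw using ew ew' by (simp add: co)
  have sq: "\<epsilon> * \<epsilon> = 1" "\<delta> * \<delta> = 1" "s * s = 1"
    using signs by auto
  define y where "y t = sqrt (1 - t * t)" for t :: real
  \<comment> \<open>In the plane of e_1, e_2 take the orthonormal pair p = (s y, \<delta> t), q =
    (t, - \<delta> s y). Then \<open>g t\<close> exchanges p with e_3 and multiplies q by
    \<epsilon>.\<close>
  define g :: "real \<Rightarrow> 'n sqmat" where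
    "g t = of_rows
      [[\<epsilon> * t * t, - \<epsilon> * \<delta> * s * t * y t, s * y t],
       [- \<epsilon> * \<delta> * s * t * y t, \<epsilon> * y t * y t, \<delta> * t],
       [s * y t, \<delta> * t, 0]]" for t
  \<comment> \<open>The middle column is an \<epsilon>-eigenvector of \<open>g t\<close> in the
    plane of e_1, e_2, as \<open>w\<close> has e_2 as \<epsilon>-eigenvector.\<close>
  define b :: "real \<Rightarrow> 'n sqmat" where
    "b t = of_rows
      [[1, - \<delta> * s * t, s * \<epsilon> * t * t],
       [0, y t, - \<epsilon> * \<delta> * t * y t],
       [0, 0, y t]]" for t
  define cms :: "(real \<times> 'n) list" where "cms = (if \<epsilon> = 1 then [(- s, ix 3)] else [(1, ix 1), (1, ix 2)])"
  have cms: "\<forall>(c, m)\<in>set cms. c \<noteq> 0"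
    using signs by (auto simp: cms_def)
  have pbv: "preferred_basis v =
      (if \<epsilon> = 1 then [axis (ix 2) 1 - \<delta> *\<^sub>R axis (ix 3) 1]
       else [axis (ix 1) 1 - \<epsilon> *\<^sub>R axis (ix 1) 1, axis (ix 2) 1 - \<delta> *\<^sub>R axis (ix 3) 1])"
    unfolding preferred_basis_eq[OF v] ix_list_3[OF d] pv using ev ev' signs by (auto simp: co)
  have pbw: "preferred_basis w =
      (if \<epsilon> = 1 then [axis (ix 1) 1 - s *\<^sub>R axis (ix 3) 1]
       else [axis (ix 1) 1 - s *\<^sub>R axis (ix 3) 1, axis (ix 2) 1 - \<epsilon> *\<^sub>R axis (ix 2) 1])"
    unfolding preferred_basis_eq[OF w] ix_list_3[OF d] pw using ew ew' signs by (auto simp: co)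
  have "orient_sign v w = (if frame_det (axis_frame cms) (preferred_basis v) > 0 then 1 else -1)"
  proof (rule orient_sign_via_path[OF v w])
    show "trace v = real CARD('n) - 2 * real (length (axis_frame cms))"
      "trace w = real CARD('n) - 2 * real (length (axis_frame cms))"
      using signs by (auto simp: trace_def v_eq w_eq co cms_def axis_frame_def)
    show "continuous_on {0..1} g"
      unfolding g_def y_def
      by (intro continuous_on_of_rows)
        (auto simp: d numeral_eq_Suc less_Suc_eq intro!: continuous_intros)
    show "g 0 = w" "g 1 = v"
      by (simp_all add: g_def y_def w_eq v_eq)
    show "transversal (neg_eigenspace v) (axis_frame cms)"
      using ev ev' signs by (intro transversal_axis_frame[OF v cms]) (auto simp: cms_def pv co)
  next
    fix t :: real assume t: "0 \<le> t" "t < 1"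
    note y = sqrt_one_minus_square[OF t, folded y_def]
    show "Finite_Cartesian_Product.transpose (g t) = g t"
      by (simp add: matrix_eq_3[OF d] Finite_Cartesian_Product.transpose_def g_def co)
    show "triangular (<) (b t)"
      using y(2) by (simp add: triangular_def b_def co)
    show "g t ** b t = b t ** w"
      unfolding matrix_eq_3[OF d]
      by (simp add: g_def b_def w_eq matrix_matrix_mult_def co)
        (simp add: algebra_simps sq sq[THEN square_absorb] y y(1)[THEN square_absorb])
  next
    fix h assume h: "h \<in> cell w"
    show "transversal (neg_eigenspace h) (axis_frame cms)"
      using ew ew' signs
      by (intro transversal_cell_axis_frame[OF w h _ cms, of "if \<epsilon> = 1 then (<) else (>)"])
        (auto simp: cms_def pw co)
  next
    show "frame_det (axis_frame cms) (map (neg_projection w) (axis_frame cms)) > 0"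
      unfolding neg_projection_axis_frame[OF w] using ew ew' signs
      by (auto simp: cms_def axis_frame_def frame_det_1 frame_det_2 pw inner_axis' axis_nth_if co)
  qed (use signs in \<open>auto simp: pbv pbw cms_def axis_frame_def frame_det_1 frame_det_2
      inner_axis' axis_nth_if co\<close>)
  then show ?thesis
    using signs
    by (auto simp: pbv cms_def axis_frame_def frame_det_1 frame_det_2 inner_axis' axis_nth_if co)
qed

text \<open>Here e_3 belongs to the eigenspace of \<open>v\<close> exactly for \<epsilon> = -1,
  which forces coordinate 3 into the frame; for \<epsilon> = 1 coordinate 3 vanishes on it and
  coordinate 1 is taken. The order relation is thus opposite to that of type fe.\<close>

lemma orient_sign_EF:
  fixes v w :: "'n::{finite,linorder} sqmat"
  assumes d: "CARD('n) = 3" and v: "signed_involution v" and w: "signed_involution w"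
    and pv: "under_perm v = Transposition.transpose (ix 1) (ix 2)"
    and pw: "under_perm w = Transposition.transpose (ix 1) (ix 3)"
    and signs: "\<epsilon> \<in> {1, -1}" "\<delta> \<in> {1, -1}" "s \<in> {1, -1}"
    and ev: "entry_sign v (ix 1) = \<delta>" "entry_sign v (ix 3) = \<epsilon>"
    and ew: "entry_sign w (ix 1) = s" "entry_sign w (ix 2) = \<epsilon>"
  shows "orient_sign v w = (if \<epsilon> = -1 \<and> \<delta> * s = 1 then -1 else 1)"
proof -
  note co = d ix_eq_iff ix_less_iff ix_le_iff of_rows_nth sum_ix_3[OF d] all_ix_3[OF d]
    Transposition.transpose_def
  note up = signed_involution_under_perm
  have ev': "entry_sign v (ix 2) = \<delta>"
    using up(3)[OF v, of "ix 1"] ev by (simp_all add: pv co)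
  have ew': "entry_sign w (ix 3) = s"
    using up(3)[OF w, of "ix 1"] ew by (simp_all add: pw co)
  have v_eq: "v = of_rows [[0, \<delta>, 0], [\<delta>, 0, 0], [0, 0, \<epsilon>]]"
    unfolding matrix_eq_3[OF d] up(1)[OF v] pv using ev ev' by (simp add: co)
  have w_eq: "w = of_rows [[0, 0, s], [0, \<epsilon>, 0], [s, 0, 0]]"
    unfolding matrix_eq_3[OF d] up(1)[OF w] pw using ew ew' by (simp add: co)
  have sq: "\<epsilon> * \<epsilon> = 1" "\<delta> * \<delta> = 1" "s * s = 1"
    using signs by auto
  define y where "y t = sqrt (1 - t * t)" for t :: real
  \<comment> \<open>Now the plane of e_2, e_3 is rotated: \<open>g t\<close> exchanges e_1 with (0,
    \<delta> t, s y) and multiplies (0, y, - \<delta> s t) by \<epsilon>.\<close>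
  define g :: "real \<Rightarrow> 'n sqmat" where
    "g t = of_rows
      [[0, \<delta> * t, s * y t],
       [\<delta> * t, \<epsilon> * y t * y t, - \<epsilon> * \<delta> * s * t * y t],
       [s * y t, - \<epsilon> * \<delta> * s * t * y t, \<epsilon> * t * t]]" for t
  define b :: "real \<Rightarrow> 'n sqmat" where
    "b t = of_rows
      [[1, \<epsilon> * \<delta> * t, 0],
       [0, 1, \<delta> * s * t],
       [0, 0, y t]]" for t
  define cms :: "(real \<times> 'n) list" where "cms = (if \<epsilon> = 1 then [(1, ix 1)] else [(- s, ix 3), (1, ix 2)])"
  have cms: "\<forall>(c, m)\<in>set cms. c \<noteq> 0"
    using signs by (auto simp: cms_def)
  have pbv: "preferred_basis v =
      (if \<epsilon> = 1 then [axis (ix 1) 1 - \<delta> *\<^sub>R axis (ix 2) 1]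
       else [axis (ix 1) 1 - \<delta> *\<^sub>R axis (ix 2) 1, axis (ix 3) 1 - \<epsilon> *\<^sub>R axis (ix 3) 1])"
    unfolding preferred_basis_eq[OF v] ix_list_3[OF d] pv using ev ev' signs by (auto simp: co)
  have pbw: "preferred_basis w =
      (if \<epsilon> = 1 then [axis (ix 1) 1 - s *\<^sub>R axis (ix 3) 1]
       else [axis (ix 1) 1 - s *\<^sub>R axis (ix 3) 1, axis (ix 2) 1 - \<epsilon> *\<^sub>R axis (ix 2) 1])"
    unfolding preferred_basis_eq[OF w] ix_list_3[OF d] pw using ew ew' signs by (auto simp: co)
  have "orient_sign v w = (if frame_det (axis_frame cms) (preferred_basis v) > 0 then 1 else -1)"
  proof (rule orient_sign_via_path[OF v w])
    show "trace v = real CARD('n) - 2 * real (length (axis_frame cms))"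
      "trace w = real CARD('n) - 2 * real (length (axis_frame cms))"
      using signs by (auto simp: trace_def v_eq w_eq co cms_def axis_frame_def)
    show "continuous_on {0..1} g"
      unfolding g_def y_def
      by (intro continuous_on_of_rows)
        (auto simp: d numeral_eq_Suc less_Suc_eq intro!: continuous_intros)
    show "g 0 = w" "g 1 = v"
      by (simp_all add: g_def y_def w_eq v_eq)
    show "transversal (neg_eigenspace v) (axis_frame cms)"
      using ev ev' signs by (intro transversal_axis_frame[OF v cms]) (auto simp: cms_def pv co)
  next
    fix t :: real assume t: "0 \<le> t" "t < 1"
    note y = sqrt_one_minus_square[OF t, folded y_def]
    show "Finite_Cartesian_Product.transpose (g t) = g t"
      by (simp add: matrix_eq_3[OF d] Finite_Cartesian_Product.transpose_def g_def co)
    show "triangular (<) (b t)"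
      using y(2) by (simp add: triangular_def b_def co)
    show "g t ** b t = b t ** w"
      unfolding matrix_eq_3[OF d]
      by (simp add: g_def b_def w_eq matrix_matrix_mult_def co)
        (simp add: algebra_simps sq sq[THEN square_absorb] y y(1)[THEN square_absorb])
  next
    fix h assume h: "h \<in> cell w"
    show "transversal (neg_eigenspace h) (axis_frame cms)"
      using ew ew' signs
      by (intro transversal_cell_axis_frame[OF w h _ cms, of "if \<epsilon> = 1 then (>) else (<)"])
        (auto simp: cms_def pw co)
  next
    show "frame_det (axis_frame cms) (map (neg_projection w) (axis_frame cms)) > 0"
      unfolding neg_projection_axis_frame[OF w] using ew ew' signs
      by (auto simp: cms_def axis_frame_def frame_det_1 frame_det_2 pw inner_axis' axis_nth_if co)
  qed (use signs in \<open>auto simp: pbv pbw cms_def axis_frame_def frame_det_1 frame_det_2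
      inner_axis' axis_nth_if co\<close>)
  then show ?thesis
    using signs
    by (auto simp: pbv cms_def axis_frame_def frame_det_1 frame_det_2 inner_axis' axis_nth_if co)
qed

text \<open>Coordinates 3 and 4 meet each cycle of \<open>v\<close> and of \<open>w\<close> once.
  Both the order of the pair and a sign change between the two preferred bases, and the effects
  cancel for all signs.\<close>

lemma orient_sign_EE_noncrossing:
  fixes v w :: "'n::{finite,linorder} sqmat"
  assumes d: "CARD('n) = 4" and v: "signed_involution v" and w: "signed_involution w"
    and pv: "under_perm v = Transposition.transpose (ix 1) (ix 3) \<circ> Transposition.transpose (ix 2) (ix 4)"
    and pw: "under_perm w = Transposition.transpose (ix 1) (ix 4) \<circ> Transposition.transpose (ix 2) (ix 3)"
    and signs: "\<epsilon> \<in> {1, -1}" "\<delta> \<in> {1, -1}" "s \<in> {1, -1}"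
    and ev: "entry_sign v (ix 1) = \<epsilon>" "entry_sign v (ix 2) = \<delta>"
    and ew: "entry_sign w (ix 1) = s" "entry_sign w (ix 2) = - (s * \<delta> * \<epsilon>)"
  shows "orient_sign v w = 1"
proof -
  note co = d ix_eq_iff ix_less_iff ix_le_iff of_rows_nth sum_ix_4[OF d] all_ix_4[OF d]
    Transposition.transpose_def
  note up = signed_involution_under_perm
  have ev': "entry_sign v (ix 3) = \<epsilon>" "entry_sign v (ix 4) = \<delta>"
    using up(3)[OF v, of "ix 1"] up(3)[OF v, of "ix 2"] ev by (simp_all add: pv co)
  have ew': "entry_sign w (ix 4) = s" "entry_sign w (ix 3) = - (s * \<delta> * \<epsilon>)"
    using up(3)[OF w, of "ix 1"] up(3)[OF w, of "ix 2"] ew by (simp_all add: pw co)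
  have v_eq: "v = of_rows [[0, 0, \<epsilon>, 0], [0, 0, 0, \<delta>], [\<epsilon>, 0, 0, 0], [0, \<delta>, 0, 0]]"
    unfolding matrix_eq_4[OF d] up(1)[OF v] pv using ev ev' by (simp add: co)
  have w_eq: "w = of_rows [[0, 0, 0, s], [0, 0, - (s * \<delta> * \<epsilon>), 0], [0, - (s * \<delta> * \<epsilon>), 0, 0], [s, 0, 0, 0]]"
    unfolding matrix_eq_4[OF d] up(1)[OF w] pw using ew ew' by (simp add: co)
  have sq: "\<epsilon> * \<epsilon> = 1" "\<delta> * \<delta> = 1" "s * s = 1"
    using signs by auto
  define y where "y t = sqrt (1 - t * t)" for t :: real
  \<comment> \<open>This is t v + y(t) w with anticommuting \<open>v\<close> and
    \<open>w\<close>.\<close>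
  define g :: "real \<Rightarrow> 'n sqmat" where
    "g t = of_rows
      [[0, 0, t * \<epsilon>, y t * s],
       [0, 0, y t * (- (s * \<delta> * \<epsilon>)), t * \<delta>],
       [t * \<epsilon>, y t * (- (s * \<delta> * \<epsilon>)), 0, 0],
       [y t * s, t * \<delta>, 0, 0]]" for t
  define b :: "real \<Rightarrow> 'n sqmat" where
    "b t = of_rows
      [[1, - s * \<delta> * t, 0, 0],
       [0, y t, 0, 0],
       [0, 0, 1, s * \<epsilon> * t],
       [0, 0, 0, y t]]" for t
  define cms :: "(real \<times> 'n) list" where "cms = [(- s, ix 4), (s * \<delta> * \<epsilon>, ix 3)]"
  have cms: "\<forall>(c, m)\<in>set cms. c \<noteq> 0"
    using signs by (auto simp: cms_def)
  have pbv: "preferred_basis v =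
      [axis (ix 1) 1 - \<epsilon> *\<^sub>R axis (ix 3) 1, axis (ix 2) 1 - \<delta> *\<^sub>R axis (ix 4) 1]"
    unfolding preferred_basis_eq[OF v] ix_list_4[OF d] pv using ev ev' signs by (auto simp: co)
  have pbw: "preferred_basis w =
      [axis (ix 1) 1 - s *\<^sub>R axis (ix 4) 1, axis (ix 2) 1 - (- (s * \<delta> * \<epsilon>)) *\<^sub>R axis (ix 3) 1]"
    unfolding preferred_basis_eq[OF w] ix_list_4[OF d] pw using ew ew' signs by (auto simp: co)
  have "orient_sign v w = (if frame_det (axis_frame cms) (preferred_basis v) > 0 then 1 else -1)"
  proof (rule orient_sign_via_path[OF v w])
    show "trace v = real CARD('n) - 2 * real (length (axis_frame cms))"
      "trace w = real CARD('n) - 2 * real (length (axis_frame cms))"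
      using signs by (auto simp: trace_def v_eq w_eq co cms_def axis_frame_def)
    show "continuous_on {0..1} g"
      unfolding g_def y_def
      by (intro continuous_on_of_rows)
        (auto simp: d numeral_eq_Suc less_Suc_eq intro!: continuous_intros)
    show "g 0 = w" "g 1 = v"
      by (simp_all add: g_def y_def w_eq v_eq)
    show "transversal (neg_eigenspace v) (axis_frame cms)"
      using ev ev' signs by (intro transversal_axis_frame[OF v cms]) (auto simp: cms_def pv co)
  next
    fix t :: real assume t: "0 \<le> t" "t < 1"
    note y = sqrt_one_minus_square[OF t, folded y_def]
    show "Finite_Cartesian_Product.transpose (g t) = g t"
      by (simp add: matrix_eq_4[OF d] Finite_Cartesian_Product.transpose_def g_def co)
    show "triangular (<) (b t)"
      using y(2) by (simp add: triangular_def b_def co)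
    show "g t ** b t = b t ** w"
      unfolding matrix_eq_4[OF d]
      by (simp add: g_def b_def w_eq matrix_matrix_mult_def co)
        (simp add: algebra_simps sq sq[THEN square_absorb] y y(1)[THEN square_absorb])
  next
    fix h assume h: "h \<in> cell w"
    show "transversal (neg_eigenspace h) (axis_frame cms)"
      using ew ew' signs
      by (intro transversal_cell_axis_frame[OF w h _ cms, of "(<)"])
        (auto simp: cms_def pw co)
  next
    show "frame_det (axis_frame cms) (map (neg_projection w) (axis_frame cms)) > 0"
      unfolding neg_projection_axis_frame[OF w] using ew ew' signs
      by (auto simp: cms_def axis_frame_def frame_det_1 frame_det_2 pw inner_axis' axis_nth_if co)
  qed (use signs in \<open>auto simp: pbv pbw cms_def axis_frame_def frame_det_1 frame_det_2
      inner_axis' axis_nth_if co\<close>)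
  then show ?thesis
    using signs
    by (auto simp: pbv cms_def axis_frame_def frame_det_1 frame_det_2 inner_axis' axis_nth_if co)
qed

text \<open>The position of the fixed vector with sign -1 decides the coordinates. Here it is e_3,
  and {1, 3} meets both cycles of \<open>v\<close>, whereas {3, 4} would miss the cycle
  (12).\<close>

lemma orient_sign_EE_crossing_pos:
  fixes v w :: "'n::{finite,linorder} sqmat"
  assumes d: "CARD('n) = 4" and v: "signed_involution v" and w: "signed_involution w"
    and pv: "under_perm v = Transposition.transpose (ix 1) (ix 2) \<circ> Transposition.transpose (ix 3) (ix 4)"
    and pw: "under_perm w = Transposition.transpose (ix 1) (ix 4)"
    and signs: "\<epsilon> \<in> {1, -1}" "\<delta> \<in> {1, -1}" "s \<in> {1, -1}"
    and ev: "entry_sign v (ix 1) = \<epsilon>" "entry_sign v (ix 3) = \<delta>"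
    and ew: "entry_sign w (ix 1) = s" "entry_sign w (ix 2) = 1" "entry_sign w (ix 3) = -1"
  shows "orient_sign v w = 1"
proof -
  note co = d ix_eq_iff ix_less_iff ix_le_iff of_rows_nth sum_ix_4[OF d] all_ix_4[OF d]
    Transposition.transpose_def
  note up = signed_involution_under_perm
  have ev': "entry_sign v (ix 2) = \<epsilon>" "entry_sign v (ix 4) = \<delta>"
    using up(3)[OF v, of "ix 1"] up(3)[OF v, of "ix 3"] ev by (simp_all add: pv co)
  have ew': "entry_sign w (ix 4) = s"
    using up(3)[OF w, of "ix 1"] ew by (simp_all add: pw co)
  have v_eq: "v = of_rows [[0, \<epsilon>, 0, 0], [\<epsilon>, 0, 0, 0], [0, 0, 0, \<delta>], [0, 0, \<delta>, 0]]"
    unfolding matrix_eq_4[OF d] up(1)[OF v] pv using ev ev' by (simp add: co)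
  have w_eq: "w = of_rows [[0, 0, 0, s], [0, 1, 0, 0], [0, 0, -1, 0], [s, 0, 0, 0]]"
    unfolding matrix_eq_4[OF d] up(1)[OF w] pw using ew ew' by (simp add: co)
  have sq: "\<epsilon> * \<epsilon> = 1" "\<delta> * \<delta> = 1" "s * s = 1"
    using signs by auto
  \<comment> \<open>Conjugation by \<open>diag(1, \<epsilon>, s \<delta>, s)\<close> reduces \<open>g\<close> and \<open>b\<close> below to the case of positive signs.\<close>
  define u c where "u t = sqrt ((1 - t * t) / 2)" and "c t = sqrt ((1 + t * t) / 2)" for t :: real
  have "c 0 = u 0" "u 0 * u 0 + u 0 * u 0 = 1"
    by (simp_all add: u_def c_def)
  then have uc0: "u 0 * (u 0 - c 0) = 0" "u 0 * (c 0 - u 0) = 0" "u 0 * (c 0 + u 0) = 1"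
    by (simp_all only: distrib_left) simp_all
  have uc1: "u 1 = 0" "c 1 = 1"
    by (simp_all add: u_def c_def)
  have uc: "u t * u t = (1 - t * t) / 2" "c t * c t = (1 + t * t) / 2" "u t > 0" "c t > 0"
    if "0 \<le> t" "t < 1" for t
  proof -
    have "t * t < 1" using mult_strict_mono[of t 1 t 1] that by simp
    moreover have "0 \<le> t * t" by simp
    ultimately show "u t * u t = (1 - t * t) / 2" "c t * c t = (1 + t * t) / 2" "u t > 0" "c t > 0"
      unfolding u_def c_def by (simp_all add: add_pos_nonneg)
  qed
  \<comment> \<open>The entries rest on u^2 + c^2 = 1 and c^2 - u^2 = t^2; u = c at t = 0, while u =
    0 and c = 1 at t = 1.\<close>
  define g :: "real \<Rightarrow> 'n sqmat" where
    "g t = of_rows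
      [[u t * (u t - c t), \<epsilon> * (t * c t), s * \<delta> * (t * u t), s * (u t * (c t + u t))],
       [\<epsilon> * (t * c t), u t * (c t + u t), \<epsilon> * s * \<delta> * (u t * (u t - c t)), \<epsilon> * s * (- (t * u t))],
       [s * \<delta> * (t * u t), s * \<delta> * \<epsilon> * (u t * (u t - c t)), - (u t * (c t + u t)), \<delta> * (t * c t)],
       [s * (u t * (c t + u t)), s * \<epsilon> * (- (t * u t)), \<delta> * (t * c t), u t * (c t - u t)]]" for t
  \<comment> \<open>Columns: e_1; a fixed vector of \<open>g t\<close> in the span of e_1, e_2; a
    (-1)-eigenvector in the span of e_1, e_2, e_3; and s g e_1. This matches the action of
    \<open>w\<close> on e_2, e_3 and e_1.\<close>
  define b :: "real \<Rightarrow> 'n sqmat" where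
    "b t = of_rows
      [[1, \<epsilon> * (t), s * \<delta> * (- t), s * (u t * (u t - c t))],
       [0, c t + u t, \<epsilon> * s * \<delta> * (c t - u t), \<epsilon> * s * (t * c t)],
       [0, 0, 2 * u t, \<delta> * (t * u t)],
       [0, 0, 0, u t * (c t + u t)]]" for t
  define cms :: "(real \<times> 'n) list" where "cms = [(1, ix 1), (1, ix 3)]"
  have cms: "\<forall>(c, m)\<in>set cms. c \<noteq> 0"
    using signs by (auto simp: cms_def)
  have pbv: "preferred_basis v =
      [axis (ix 1) 1 - \<epsilon> *\<^sub>R axis (ix 2) 1, axis (ix 3) 1 - \<delta> *\<^sub>R axis (ix 4) 1]"
    unfolding preferred_basis_eq[OF v] ix_list_4[OF d] pv using ev ev' signs by (auto simp: co)
  have pbw: "preferred_basis w =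
      [axis (ix 1) 1 - s *\<^sub>R axis (ix 4) 1, axis (ix 3) 1 - (-1) *\<^sub>R axis (ix 3) 1]"
    unfolding preferred_basis_eq[OF w] ix_list_4[OF d] pw using ew ew' signs by (auto simp: co)
  have "orient_sign v w = (if frame_det (axis_frame cms) (preferred_basis v) > 0 then 1 else -1)"
  proof (rule orient_sign_via_path[OF v w])
    show "trace v = real CARD('n) - 2 * real (length (axis_frame cms))"
      "trace w = real CARD('n) - 2 * real (length (axis_frame cms))"
      using signs by (auto simp: trace_def v_eq w_eq co cms_def axis_frame_def)
    show "continuous_on {0..1} g"
      unfolding g_def u_def c_def
      by (intro continuous_on_of_rows)
        (auto simp: d numeral_eq_Suc less_Suc_eq intro!: continuous_intros)
    show "g 0 = w" "g 1 = v"
      by (simp_all add: g_def uc0 uc1 w_eq v_eq)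
    show "transversal (neg_eigenspace v) (axis_frame cms)"
      using ev ev' signs by (intro transversal_axis_frame[OF v cms]) (auto simp: cms_def pv co)
  next
    fix t :: real assume t: "0 \<le> t" "t < 1"
    note y = uc(1,2)[OF t]
    show "Finite_Cartesian_Product.transpose (g t) = g t"
      by (simp add: matrix_eq_4[OF d] Finite_Cartesian_Product.transpose_def g_def co)
    show "triangular (<) (b t)"
      using uc(3,4)[OF t] by (simp add: triangular_def b_def co)
    show "g t ** b t = b t ** w"
      unfolding matrix_eq_4[OF d]
      by (simp add: g_def b_def w_eq matrix_matrix_mult_def co)
        (simp add: algebra_simps sq sq[THEN square_absorb] y y[THEN square_absorb] field_simps)
  next
    fix h assume h: "h \<in> cell w"
    show "transversal (neg_eigenspace h) (axis_frame cms)"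
      using ew ew' signs
      by (intro transversal_cell_axis_frame[OF w h _ cms, of "(>)"])
        (auto simp: cms_def pw co)
  next
    show "frame_det (axis_frame cms) (map (neg_projection w) (axis_frame cms)) > 0"
      unfolding neg_projection_axis_frame[OF w] using ew ew' signs
      by (auto simp: cms_def axis_frame_def frame_det_1 frame_det_2 pw inner_axis' axis_nth_if co)
  qed (use signs in \<open>auto simp: pbv pbw cms_def axis_frame_def frame_det_1 frame_det_2
      inner_axis' axis_nth_if co\<close>)
  then show ?thesis
    using signs
    by (auto simp: pbv cms_def axis_frame_def frame_det_1 frame_det_2 inner_axis' axis_nth_if co)
qed

text \<open>Now e_2 has sign -1, so {1, 2} would miss the cycle (34) of \<open>v\<close> and {2, 4}
  is taken. Negation exchanges the two eigenspaces, so the sign does not carry over from the other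
  case although the path does.\<close>

lemma orient_sign_EE_crossing_neg:
  fixes v w :: "'n::{finite,linorder} sqmat"
  assumes d: "CARD('n) = 4" and v: "signed_involution v" and w: "signed_involution w"
    and pv: "under_perm v = Transposition.transpose (ix 1) (ix 2) \<circ> Transposition.transpose (ix 3) (ix 4)"
    and pw: "under_perm w = Transposition.transpose (ix 1) (ix 4)"
    and signs: "\<epsilon> \<in> {1, -1}" "\<delta> \<in> {1, -1}" "s \<in> {1, -1}"
    and ev: "entry_sign v (ix 1) = \<epsilon>" "entry_sign v (ix 3) = \<delta>"
    and ew: "entry_sign w (ix 1) = s" "entry_sign w (ix 2) = -1" "entry_sign w (ix 3) = 1"
  shows "orient_sign v w = (if s * \<delta> * \<epsilon> = -1 then -1 else 1)"
proof -
  note co = d ix_eq_iff ix_less_iff ix_le_iff of_rows_nth sum_ix_4[OF d] all_ix_4[OF d]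
    Transposition.transpose_def
  note up = signed_involution_under_perm
  have ev': "entry_sign v (ix 2) = \<epsilon>" "entry_sign v (ix 4) = \<delta>"
    using up(3)[OF v, of "ix 1"] up(3)[OF v, of "ix 3"] ev by (simp_all add: pv co)
  have ew': "entry_sign w (ix 4) = s"
    using up(3)[OF w, of "ix 1"] ew by (simp_all add: pw co)
  have v_eq: "v = of_rows [[0, \<epsilon>, 0, 0], [\<epsilon>, 0, 0, 0], [0, 0, 0, \<delta>], [0, 0, \<delta>, 0]]"
    unfolding matrix_eq_4[OF d] up(1)[OF v] pv using ev ev' by (simp add: co)
  have w_eq: "w = of_rows [[0, 0, 0, s], [0, -1, 0, 0], [0, 0, 1, 0], [s, 0, 0, 0]]"
    unfolding matrix_eq_4[OF d] up(1)[OF w] pw using ew ew' by (simp add: co)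
  have sq: "\<epsilon> * \<epsilon> = 1" "\<delta> * \<delta> = 1" "s * s = 1"
    using signs by auto
  define u c where "u t = sqrt ((1 - t * t) / 2)" and "c t = sqrt ((1 + t * t) / 2)" for t :: real
  have "c 0 = u 0" "u 0 * u 0 + u 0 * u 0 = 1"
    by (simp_all add: u_def c_def)
  then have uc0: "u 0 * (u 0 - c 0) = 0" "u 0 * (c 0 - u 0) = 0" "u 0 * (c 0 + u 0) = 1"
    by (simp_all only: distrib_left) simp_all
  have uc1: "u 1 = 0" "c 1 = 1"
    by (simp_all add: u_def c_def)
  have uc: "u t * u t = (1 - t * t) / 2" "c t * c t = (1 + t * t) / 2" "u t > 0" "c t > 0"
    if "0 \<le> t" "t < 1" for t
  proof -
    have "t * t < 1" using mult_strict_mono[of t 1 t 1] that by simp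
    moreover have "0 \<le> t * t" by simp
    ultimately show "u t * u t = (1 - t * t) / 2" "c t * c t = (1 + t * t) / 2" "u t > 0" "c t > 0"
      unfolding u_def c_def by (simp_all add: add_pos_nonneg)
  qed
  \<comment> \<open>Obtained from the path of the other case as - D g D with D = diag(1, -1, 1, -1);
    \<open>b\<close> becomes D b D.\<close>
  define g :: "real \<Rightarrow> 'n sqmat" where
    "g t = of_rows
      [[u t * (c t - u t), \<epsilon> * (t * c t), s * \<delta> * (- (t * u t)), s * (u t * (c t + u t))],
       [\<epsilon> * (t * c t), - (u t * (c t + u t)), \<epsilon> * s * \<delta> * (u t * (u t - c t)), \<epsilon> * s * (t * u t)],
       [s * \<delta> * (- (t * u t)), s * \<delta> * \<epsilon> * (u t * (u t - c t)), u t * (c t + u t), \<delta> * (t * c t)],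
       [s * (u t * (c t + u t)), s * \<epsilon> * (t * u t), \<delta> * (t * c t), u t * (u t - c t)]]" for t
  define b :: "real \<Rightarrow> 'n sqmat" where
    "b t = of_rows
      [[1, \<epsilon> * (- t), s * \<delta> * (- t), s * (u t * (c t - u t))],
       [0, c t + u t, \<epsilon> * s * \<delta> * (u t - c t), \<epsilon> * s * (t * c t)],
       [0, 0, 2 * u t, \<delta> * (- (t * u t))],
       [0, 0, 0, u t * (c t + u t)]]" for t
  define cms :: "(real \<times> 'n) list" where "cms = [(- s, ix 4), (1, ix 2)]"
  have cms: "\<forall>(c, m)\<in>set cms. c \<noteq> 0"
    using signs by (auto simp: cms_def)
  have pbv: "preferred_basis v =
      [axis (ix 1) 1 - \<epsilon> *\<^sub>R axis (ix 2) 1, axis (ix 3) 1 - \<delta> *\<^sub>R axis (ix 4) 1]"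
    unfolding preferred_basis_eq[OF v] ix_list_4[OF d] pv using ev ev' signs by (auto simp: co)
  have pbw: "preferred_basis w =
      [axis (ix 1) 1 - s *\<^sub>R axis (ix 4) 1, axis (ix 2) 1 - (-1) *\<^sub>R axis (ix 2) 1]"
    unfolding preferred_basis_eq[OF w] ix_list_4[OF d] pw using ew ew' signs by (auto simp: co)
  have "orient_sign v w = (if frame_det (axis_frame cms) (preferred_basis v) > 0 then 1 else -1)"
  proof (rule orient_sign_via_path[OF v w])
    show "trace v = real CARD('n) - 2 * real (length (axis_frame cms))"
      "trace w = real CARD('n) - 2 * real (length (axis_frame cms))"
      using signs by (auto simp: trace_def v_eq w_eq co cms_def axis_frame_def)
    show "continuous_on {0..1} g"
      unfolding g_def u_def c_def
      by (intro continuous_on_of_rows)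
        (auto simp: d numeral_eq_Suc less_Suc_eq intro!: continuous_intros)
    show "g 0 = w" "g 1 = v"
      by (simp_all add: g_def uc0 uc1 w_eq v_eq)
    show "transversal (neg_eigenspace v) (axis_frame cms)"
      using ev ev' signs by (intro transversal_axis_frame[OF v cms]) (auto simp: cms_def pv co)
  next
    fix t :: real assume t: "0 \<le> t" "t < 1"
    note y = uc(1,2)[OF t]
    show "Finite_Cartesian_Product.transpose (g t) = g t"
      by (simp add: matrix_eq_4[OF d] Finite_Cartesian_Product.transpose_def g_def co)
    show "triangular (<) (b t)"
      using uc(3,4)[OF t] by (simp add: triangular_def b_def co)
    show "g t ** b t = b t ** w"
      unfolding matrix_eq_4[OF d]
      by (simp add: g_def b_def w_eq matrix_matrix_mult_def co)
        (simp add: algebra_simps sq sq[THEN square_absorb] y y[THEN square_absorb] field_simps)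
  next
    fix h assume h: "h \<in> cell w"
    show "transversal (neg_eigenspace h) (axis_frame cms)"
      using ew ew' signs
      by (intro transversal_cell_axis_frame[OF w h _ cms, of "(<)"])
        (auto simp: cms_def pw co)
  next
    show "frame_det (axis_frame cms) (map (neg_projection w) (axis_frame cms)) > 0"
      unfolding neg_projection_axis_frame[OF w] using ew ew' signs
      by (auto simp: cms_def axis_frame_def frame_det_1 frame_det_2 pw inner_axis' axis_nth_if co)
  qed (use signs in \<open>auto simp: pbv pbw cms_def axis_frame_def frame_det_1 frame_det_2
      inner_axis' axis_nth_if co\<close>)
  then show ?thesis
    using signs
    by (auto simp: pbv cms_def axis_frame_def frame_det_1 frame_det_2 inner_axis' axis_nth_if co)
qed

text \<open>Leading coordinates give {1, 2} or {3, 4}, and each misses a cycle of \<open>v\<close>.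
  The mixed pair {2, 3} meets both cycles, at the price of using orthogonality of the cell
  elements.\<close>

lemma orient_sign_ED:
  fixes v w :: "'n::{finite,linorder} sqmat"
  assumes d: "CARD('n) = 4" and v: "signed_involution v" and w: "signed_involution w"
    and pv: "under_perm v = Transposition.transpose (ix 1) (ix 2) \<circ> Transposition.transpose (ix 3) (ix 4)"
    and pw: "under_perm w = Transposition.transpose (ix 1) (ix 3) \<circ> Transposition.transpose (ix 2) (ix 4)"
    and signs: "\<epsilon> \<in> {1, -1}" "\<delta> \<in> {1, -1}" "s \<in> {1, -1}"
    and ev: "entry_sign v (ix 1) = \<epsilon>" "entry_sign v (ix 3) = \<delta>"
    and ew: "entry_sign w (ix 1) = s" "entry_sign w (ix 2) = - (s * \<delta> * \<epsilon>)"
  shows "orient_sign v w = (if s * \<epsilon> = 1 then -1 else 1)"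
proof -
  note co = d ix_eq_iff ix_less_iff ix_le_iff of_rows_nth sum_ix_4[OF d] all_ix_4[OF d]
    Transposition.transpose_def
  note up = signed_involution_under_perm
  have ev': "entry_sign v (ix 2) = \<epsilon>" "entry_sign v (ix 4) = \<delta>"
    using up(3)[OF v, of "ix 1"] up(3)[OF v, of "ix 3"] ev by (simp_all add: pv co)
  have ew': "entry_sign w (ix 3) = s" "entry_sign w (ix 4) = - (s * \<delta> * \<epsilon>)"
    using up(3)[OF w, of "ix 1"] up(3)[OF w, of "ix 2"] ew by (simp_all add: pw co)
  have v_eq: "v = of_rows [[0, \<epsilon>, 0, 0], [\<epsilon>, 0, 0, 0], [0, 0, 0, \<delta>], [0, 0, \<delta>, 0]]"
    unfolding matrix_eq_4[OF d] up(1)[OF v] pv using ev ev' by (simp add: co)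
  have w_eq: "w = of_rows [[0, 0, s, 0], [0, 0, 0, - (s * \<delta> * \<epsilon>)], [s, 0, 0, 0], [0, - (s * \<delta> * \<epsilon>), 0, 0]]"
    unfolding matrix_eq_4[OF d] up(1)[OF w] pw using ew ew' by (simp add: co)
  have sq: "\<epsilon> * \<epsilon> = 1" "\<delta> * \<delta> = 1" "s * s = 1"
    using signs by auto
  define y where "y t = sqrt (1 - t * t)" for t :: real
  define g :: "real \<Rightarrow> 'n sqmat" where
    "g t = of_rows
      [[0, t * \<epsilon>, y t * s, 0],
       [t * \<epsilon>, 0, 0, y t * (- (s * \<delta> * \<epsilon>))],
       [y t * s, 0, 0, t * \<delta>],
       [0, y t * (- (s * \<delta> * \<epsilon>)), t * \<delta>, 0]]" for t
  define b :: "real \<Rightarrow> 'n sqmat" where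
    "b t = of_rows
      [[1, 0, 0, - s * \<delta> * t],
       [0, 1, s * \<epsilon> * t, 0],
       [0, 0, y t, 0],
       [0, 0, 0, y t]]" for t
  define cms :: "(real \<times> 'n) list" where "cms = [(- s, ix 3), (1, ix 2)]"
  have cms: "\<forall>(c, m)\<in>set cms. c \<noteq> 0"
    using signs by (auto simp: cms_def)
  have pbv: "preferred_basis v =
      [axis (ix 1) 1 - \<epsilon> *\<^sub>R axis (ix 2) 1, axis (ix 3) 1 - \<delta> *\<^sub>R axis (ix 4) 1]"
    unfolding preferred_basis_eq[OF v] ix_list_4[OF d] pv using ev ev' signs by (auto simp: co)
  have pbw: "preferred_basis w =
      [axis (ix 1) 1 - s *\<^sub>R axis (ix 3) 1, axis (ix 2) 1 - (- (s * \<delta> * \<epsilon>)) *\<^sub>R axis (ix 4) 1]"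
    unfolding preferred_basis_eq[OF w] ix_list_4[OF d] pw using ew ew' signs by (auto simp: co)
  have "orient_sign v w = (if frame_det (axis_frame cms) (preferred_basis v) > 0 then 1 else -1)"
  proof (rule orient_sign_via_path[OF v w])
    show "trace v = real CARD('n) - 2 * real (length (axis_frame cms))"
      "trace w = real CARD('n) - 2 * real (length (axis_frame cms))"
      using signs by (auto simp: trace_def v_eq w_eq co cms_def axis_frame_def)
    show "continuous_on {0..1} g"
      unfolding g_def y_def
      by (intro continuous_on_of_rows)
        (auto simp: d numeral_eq_Suc less_Suc_eq intro!: continuous_intros)
    show "g 0 = w" "g 1 = v"
      by (simp_all add: g_def y_def w_eq v_eq)
    show "transversal (neg_eigenspace v) (axis_frame cms)"
      using ev ev' signs by (intro transversal_axis_frame[OF v cms]) (auto simp: cms_def pv co)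
  next
    fix t :: real assume t: "0 \<le> t" "t < 1"
    note y = sqrt_one_minus_square[OF t, folded y_def]
    show "Finite_Cartesian_Product.transpose (g t) = g t"
      by (simp add: matrix_eq_4[OF d] Finite_Cartesian_Product.transpose_def g_def co)
    show "triangular (<) (b t)"
      using y(2) by (simp add: triangular_def b_def co)
    show "g t ** b t = b t ** w"
      unfolding matrix_eq_4[OF d]
      by (simp add: g_def b_def w_eq matrix_matrix_mult_def co)
        (simp add: algebra_simps sq sq[THEN square_absorb] y y(1)[THEN square_absorb])
  next
    fix h assume h: "h \<in> cell w"
    show "transversal (neg_eigenspace h) (axis_frame cms)"
      unfolding transversal_def
      \<comment> \<open>Leading coordinates alone do not exclude an eigenvector supported on 1 and 4. Since \<open>h\<^sub>4\<^sub>1 = 0\<close>,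
        its coordinate 1 could only be nonzero if \<open>h\<^sub>1\<^sub>1 = -1\<close>; but column 1 is a unit vector with \<open>h\<^sub>3\<^sub>1 \<noteq> 0\<close>.\<close>
    proof (intro ballI impI)
      fix y assume y: "y \<in> neg_eigenspace h" "\<forall>x\<in>set (axis_frame cms). x \<bullet> y = 0"
      obtain b b' where b: "triangular (<) b" "triangular (<) b'" "h = b ** w ** b'"
        using cell_decomposition[OF h up(4)[OF w]] by blast
      have "h $ ix 4 $ ix 1 = 0" "h $ ix 3 $ ix 1 = b $ ix 3 $ ix 3 * s * b' $ ix 1 $ ix 1"
        using b(1,2) by (simp_all add: triangular_def b(3) w_eq matrix_matrix_mult_def co)
      then have h41: "h $ ix 4 $ ix 1 = 0" and h31: "h $ ix 3 $ ix 1 \<noteq> 0"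
        using b(1,2) signs by (auto simp: triangular_def less_le)
      have hG: "h \<in> Gk (neg_index w)" using h by (simp add: cell_def)
      have sym: "h $ i $ j = h $ j $ i" for i j
        using arg_cong[OF Gk_symmetric[OF hG], of "\<lambda>A. A $ i $ j"]
        by (simp add: Finite_Cartesian_Product.transpose_def)
      have y23: "y $ ix 2 = 0" "y $ ix 3 = 0"
        using axis_frame_orthogonal_nth[OF cms y(2)] by (auto simp: cms_def)
      have "(h *v y) $ ix 1 = - y $ ix 1"
        using y(1) by (simp add: neg_eigenspace_def)
      then have h11: "h $ ix 1 $ ix 1 * y $ ix 1 = - y $ ix 1"
        using h41 sym[of "ix 1" "ix 4"] y23 by (simp add: matrix_vector_mult_def co)
      have "(h ** h) $ ix 1 $ ix 1 = 1"
        using hG by (simp add: Gk_def mat_def)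
      then have col: "(h $ ix 1 $ ix 1)\<^sup>2 + (h $ ix 2 $ ix 1)\<^sup>2 + (h $ ix 3 $ ix 1)\<^sup>2 = 1"
        using h41 sym[of "ix 1" "ix 2"] sym[of "ix 1" "ix 3"]
        by (simp add: matrix_matrix_mult_def co power2_eq_square)
      have y1: "y $ ix 1 = 0"
      proof (rule ccontr)
        assume "y $ ix 1 \<noteq> 0"
        then have "h $ ix 1 $ ix 1 = - 1"
          using h11 by (metis mult_minus1 mult_right_cancel)
        then have "(h $ ix 2 $ ix 1)\<^sup>2 + (h $ ix 3 $ ix 1)\<^sup>2 = 0"
          using col by simp
        then show False
          using h31 by (simp add: sum_power2_eq_zero_iff)
      qed
      \<comment> \<open>Once coordinate 1 is known to vanish, the frame contains the full set {1, 2}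
        needed for first nonzero coordinates.\<close>
      have "transversal (neg_eigenspace h) (axis_frame ((1, ix 1) # cms))"
        using cms by (intro transversal_cell_axis_frame[OF w h, of "(>)"]) (auto simp: cms_def pw co)
      then show "y = 0"
        using y y1 by (auto simp: transversal_def axis_frame_def inner_axis')
    qed
  next
    show "frame_det (axis_frame cms) (map (neg_projection w) (axis_frame cms)) > 0"
      unfolding neg_projection_axis_frame[OF w] using ew ew' signs
      by (auto simp: cms_def axis_frame_def frame_det_1 frame_det_2 pw inner_axis' axis_nth_if co)
  qed (use signs in \<open>auto simp: pbv pbw cms_def axis_frame_def frame_det_1 frame_det_2
      inner_axis' axis_nth_if co\<close>)
  then show ?thesis
    using signs
    by (auto simp: pbv cms_def axis_frame_def frame_det_1 frame_det_2 inner_axis' axis_nth_if co)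
qed

section \<open>From the signs of \<sigma> to the entry signs of \<open>v\<close> and
  \<open>w\<close>\<close>

lemma mult_signed_involutions_axis:
  assumes "signed_involution v" "signed_involution w"
  shows "(v ** w) *v axis i 1 =
    (entry_sign w i * entry_sign v (under_perm w i)) *\<^sub>R axis (under_perm v (under_perm w i)) 1"
  by (simp add: signed_involution_axis assms matrix_vector_mult_scaleR
      flip: matrix_vector_mul_assoc)

theorem lemma4p14:
  fixes v w :: "'n::{finite,linorder} sqmat"
    and i j :: 'n and \<alpha> \<beta> \<gamma> :: real and T :: rise_type
  assumes "signed_involution v" and "signed_involution w"
    and "v \<in> closure (cell w)"
    and "int (cell_dim v) = int (cell_dim w) - 1"
    and "\<alpha> \<in> {1, -1}" and "\<beta> \<in> {1, -1}" and "\<gamma> \<in> {1, -1}"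
    and "model_rise T v w i j \<alpha> \<beta> \<gamma>"
  shows "orient_sign v w =
      (if (T = FF \<and> (entry_sign v i, \<alpha>) = (1, -1)) \<or>
          (T = FE \<and> (entry_sign v i, \<beta>) = (1, -1)) \<or>
          (T = EF \<and> (entry_sign v j, \<beta>) = (-1, 1)) \<or>
          (T = EE_crossing \<and> \<alpha> * \<beta> = -1 \<and> \<gamma> * entry_sign v i = -1) \<or>
          (T = ED \<and> \<beta> = -1)
       then -1 else 1)
    \<and> (T = EE_noncrossing \<longrightarrow> orient_sign v w = 1)"
proof -
  note v = \<open>signed_involution v\<close> and w = \<open>signed_involution w\<close>
  note \<sigma> = mult_signed_involutions_axis[OF v w]
  note sv = signed_involution_under_perm(2)[OF v] and sw = signed_involution_under_perm(2)[OF w]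
  note pv = signed_involution_under_perm(3)[OF v] and pw = signed_involution_under_perm(3)[OF w]
  note co = ix_eq_iff Transposition.transpose_def
  show ?thesis
  proof (cases T)
    case FF
    then have d: "CARD('n) = 2" and m: "under_perm v = id"
        "under_perm w = Transposition.transpose (ix 1) (ix 2)"
      and ij: "i = ix 1"
      and \<sigma>': "(v ** w) *v axis (ix 1) 1 = \<alpha> *\<^sub>R axis (ix 2) 1"
        "(v ** w) *v axis (ix 2) 1 = - \<alpha> *\<^sub>R axis (ix 1) 1"
      using assms(8) by (auto simp: model_rise_def Let_def)
    have w': "entry_sign w (ix 2) = entry_sign w (ix 1)"
      using pw[of "ix 1"] by (simp add: m d co)
    have \<alpha>: "entry_sign w (ix 1) * entry_sign v (ix 2) = \<alpha>"
        "entry_sign w (ix 2) * entry_sign v (ix 1) = - \<alpha>"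
      using \<sigma>' unfolding \<sigma> m by (simp_all add: d co del: scaleR_minus_left)
    \<comment> \<open>The opposite signs of \<sigma> on e_1 and e_2 must come from \<open>v\<close>,
      since \<open>w\<close> has equal signs on its 2-cycle.\<close>
    then have v2: "entry_sign v (ix 2) = - entry_sign v (ix 1)"
      using sv[of "ix 1"] sv[of "ix 2"] sw[of "ix 1"] w' by auto
    show ?thesis
      using orient_sign_FF[OF d v w m sv sw refl v2 refl] FF ij \<alpha> v2 sv[of "ix 1"] sw[of "ix 1"]
      by auto
  next
    case FE
    then have d: "CARD('n) = 3" and m: "under_perm v = Transposition.transpose (ix 2) (ix 3)"
        "under_perm w = Transposition.transpose (ix 1) (ix 3)"
      and ij: "i = ix 1"
      and \<sigma>': "(v ** w) *v axis (ix 1) 1 = \<beta> *\<^sub>R axis (ix 2) 1"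
        "(v ** w) *v axis (ix 2) 1 = \<alpha> *\<^sub>R axis (ix 3) 1"
        "(v ** w) *v axis (ix 3) 1 = (\<alpha> * \<beta>) *\<^sub>R axis (ix 1) 1"
      using assms(8) by (auto simp: model_rise_def Let_def)
    have v': "entry_sign v (ix 3) = entry_sign v (ix 2)"
      and w': "entry_sign w (ix 3) = entry_sign w (ix 1)"
      using pv[of "ix 2"] pw[of "ix 1"] by (simp_all add: m d co)
    have \<alpha>\<beta>: "entry_sign w (ix 1) * entry_sign v (ix 3) = \<beta>"
        "entry_sign w (ix 2) * entry_sign v (ix 2) = \<alpha>"
        "entry_sign w (ix 3) * entry_sign v (ix 1) = \<alpha> * \<beta>"
      using \<sigma>' unfolding \<sigma> m by (simp_all add: d co del: scaleR_minus_left)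
    then have w2: "entry_sign w (ix 2) = entry_sign v (ix 1)"
      using sv[of "ix 1"] sv[of "ix 2"] sw[of "ix 1"] sw[of "ix 2"] v' w' by auto
    show ?thesis
      using orient_sign_FE[OF d v w m sv sv sw refl refl refl w2] FE ij \<alpha>\<beta> v'
      by (auto simp: mult.commute)
  next
    case EF
    then have d: "CARD('n) = 3" and m: "under_perm v = Transposition.transpose (ix 1) (ix 2)"
        "under_perm w = Transposition.transpose (ix 1) (ix 3)"
      and ij: "j = ix 3"
      and \<sigma>': "(v ** w) *v axis (ix 1) 1 = \<alpha> *\<^sub>R axis (ix 3) 1"
        "(v ** w) *v axis (ix 3) 1 = \<beta> *\<^sub>R axis (ix 2) 1"
        "(v ** w) *v axis (ix 2) 1 = (\<alpha> * \<beta>) *\<^sub>R axis (ix 1) 1"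
      using assms(8) by (auto simp: model_rise_def Let_def)
    have v': "entry_sign v (ix 2) = entry_sign v (ix 1)"
      and w': "entry_sign w (ix 3) = entry_sign w (ix 1)"
      using pv[of "ix 1"] pw[of "ix 1"] by (simp_all add: m d co)
    have \<alpha>\<beta>: "entry_sign w (ix 1) * entry_sign v (ix 3) = \<alpha>"
        "entry_sign w (ix 3) * entry_sign v (ix 1) = \<beta>"
        "entry_sign w (ix 2) * entry_sign v (ix 2) = \<alpha> * \<beta>"
      using \<sigma>' unfolding \<sigma> m by (simp_all add: d co del: scaleR_minus_left)
    then have w2: "entry_sign w (ix 2) = entry_sign v (ix 3)"
      using sv[of "ix 1"] sv[of "ix 3"] sw[of "ix 1"] sw[of "ix 2"] v' w' by auto
    show ?thesis
      using orient_sign_EF[OF d v w m sv sv sw refl refl refl w2] EF ij \<alpha>\<beta> w'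
      by (auto simp: mult.commute)
  next
    case EE_noncrossing
    then have d: "CARD('n) = 4"
      and m: "under_perm v = Transposition.transpose (ix 1) (ix 3) \<circ> Transposition.transpose (ix 2) (ix 4)"
        "under_perm w = Transposition.transpose (ix 1) (ix 4) \<circ> Transposition.transpose (ix 2) (ix 3)"
      and \<sigma>': "(v ** w) *v axis (ix 1) 1 = \<beta> *\<^sub>R axis (ix 2) 1"
        "(v ** w) *v axis (ix 2) 1 = - \<beta> *\<^sub>R axis (ix 1) 1"
      using assms(8) by (auto simp: model_rise_def Let_def)
    have v': "entry_sign v (ix 3) = entry_sign v (ix 1)" "entry_sign v (ix 4) = entry_sign v (ix 2)"
      using pv[of "ix 1"] pv[of "ix 2"] by (simp_all add: m d co)
    have \<beta>: "entry_sign w (ix 1) * entry_sign v (ix 4) = \<beta>"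
        "entry_sign w (ix 2) * entry_sign v (ix 3) = - \<beta>"
      using \<sigma>' unfolding \<sigma> m by (simp_all add: d co del: scaleR_minus_left)
    then have w2: "entry_sign w (ix 2) =
        - (entry_sign w (ix 1) * entry_sign v (ix 2) * entry_sign v (ix 1))"
      using sv[of "ix 1"] sv[of "ix 2"] sw[of "ix 1"] sw[of "ix 2"] v' by auto
    show ?thesis
      using orient_sign_EE_noncrossing[OF d v w m sv sv sw refl refl refl w2] EE_noncrossing
      by simp
  next
    case EE_crossing
    then have d: "CARD('n) = 4"
      and m: "under_perm v = Transposition.transpose (ix 1) (ix 2) \<circ> Transposition.transpose (ix 3) (ix 4)"
        "under_perm w = Transposition.transpose (ix 1) (ix 4)"
      and ij: "i = ix 1"
      and \<sigma>': "(v ** w) *v axis (ix 1) 1 = \<gamma> *\<^sub>R axis (ix 3) 1"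
        "(v ** w) *v axis (ix 3) 1 = \<alpha> *\<^sub>R axis (ix 4) 1"
        "(v ** w) *v axis (ix 4) 1 = \<beta> *\<^sub>R axis (ix 2) 1"
        "(v ** w) *v axis (ix 2) 1 = - (\<alpha> * \<beta> * \<gamma>) *\<^sub>R axis (ix 1) 1"
      using assms(8) by (auto simp: model_rise_def Let_def)
    have v': "entry_sign v (ix 2) = entry_sign v (ix 1)" "entry_sign v (ix 4) = entry_sign v (ix 3)"
      and w': "entry_sign w (ix 4) = entry_sign w (ix 1)"
      using pv[of "ix 1"] pv[of "ix 3"] pw[of "ix 1"] by (simp_all add: m d co)
    have \<alpha>\<beta>\<gamma>: "entry_sign w (ix 1) * entry_sign v (ix 4) = \<gamma>"
        "entry_sign w (ix 3) * entry_sign v (ix 3) = \<alpha>"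
        "entry_sign w (ix 4) * entry_sign v (ix 1) = \<beta>"
        "entry_sign w (ix 2) * entry_sign v (ix 2) = - (\<alpha> * \<beta> * \<gamma>)"
      using \<sigma>' unfolding \<sigma> m by (simp_all add: d co del: scaleR_minus_left)
    \<comment> \<open>The minus sign in the last value of \<sigma> survives because every other sign
      occurs twice in the product.\<close>
    then have w3: "entry_sign w (ix 3) = - entry_sign w (ix 2)"
      using sv[of "ix 1"] sv[of "ix 3"] sw[of "ix 1"] sw[of "ix 2"] sw[of "ix 3"] v' w' by auto
    from sw[of "ix 2"] consider (pos) "entry_sign w (ix 2) = 1" | (neg) "entry_sign w (ix 2) = -1"
      by auto
    then show ?thesis
    proof cases
      case pos
      then have "entry_sign w (ix 3) = -1" using w3 by simp
      then have "orient_sign v w = 1"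
        using orient_sign_EE_crossing_pos[OF d v w m sv sv sw refl refl refl pos] by simp
      \<comment> \<open>Here \<alpha> \<beta> = - \<gamma> \<epsilon>_i, so the two products cannot
        both be -1.\<close>
      moreover have "\<not> (\<alpha> * \<beta> = -1 \<and> \<gamma> * entry_sign v i = -1)"
        using \<alpha>\<beta>\<gamma> v' w' w3 pos ij sv[of "ix 1"] sv[of "ix 3"] sw[of "ix 1"] by auto
      ultimately show ?thesis using EE_crossing by simp
    next
      case neg
      then have "entry_sign w (ix 3) = 1" using w3 by simp
      then have "orient_sign v w =
          (if entry_sign w (ix 1) * entry_sign v (ix 3) * entry_sign v (ix 1) = -1 then -1 else 1)"
        using orient_sign_EE_crossing_neg[OF d v w m sv sv sw refl refl refl neg] by simp
      \<comment> \<open>Here \<alpha> \<beta> and \<gamma> \<epsilon>_i both equal the product on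
        the right, so the two conditions coincide.\<close>
      moreover have "\<alpha> * \<beta> = -1 \<and> \<gamma> * entry_sign v i = -1 \<longleftrightarrow>
          entry_sign w (ix 1) * entry_sign v (ix 3) * entry_sign v (ix 1) = -1"
        using \<alpha>\<beta>\<gamma> v' w' w3 neg ij sv[of "ix 1"] sv[of "ix 3"] sw[of "ix 1"] by auto
      ultimately show ?thesis using EE_crossing by simp
    qed
  next
    case ED
    then have d: "CARD('n) = 4"
      and m: "under_perm v = Transposition.transpose (ix 1) (ix 2) \<circ> Transposition.transpose (ix 3) (ix 4)"
        "under_perm w = Transposition.transpose (ix 1) (ix 3) \<circ> Transposition.transpose (ix 2) (ix 4)"
      and \<sigma>': "(v ** w) *v axis (ix 2) 1 = \<beta> *\<^sub>R axis (ix 3) 1"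
        "(v ** w) *v axis (ix 3) 1 = - \<beta> *\<^sub>R axis (ix 2) 1"
      using assms(8) by (auto simp: model_rise_def Let_def)
    have v': "entry_sign v (ix 4) = entry_sign v (ix 3)"
      and w': "entry_sign w (ix 3) = entry_sign w (ix 1)"
      using pv[of "ix 3"] pw[of "ix 1"] by (simp_all add: m d co)
    have \<beta>: "entry_sign w (ix 2) * entry_sign v (ix 4) = \<beta>"
        "entry_sign w (ix 3) * entry_sign v (ix 1) = - \<beta>"
      using \<sigma>' unfolding \<sigma> m by (simp_all add: d co del: scaleR_minus_left)
    then have w2: "entry_sign w (ix 2) =
        - (entry_sign w (ix 1) * entry_sign v (ix 3) * entry_sign v (ix 1))"
      using sv[of "ix 1"] sv[of "ix 3"] sw[of "ix 1"] sw[of "ix 2"] v' w' by auto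
    show ?thesis
      using orient_sign_ED[OF d v w m sv sv sw refl refl refl w2] ED \<beta> w' by auto
  qed
qed

end
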